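(* Let $K \subset \mathbb R^3$ be a regular convex non-ellipsoidal cone with everywhere positively curved boundary of class $C^k$, $k \geq 5$. Let $\gamma$ be the projective image of $\partial K$ in $\mathbb{RP}^2$. Then any two balanced $2\pi$-periodic parametrizations of $\gamma$, by variables $t$ and $s$ respectively, differ by an additive constant, i.e. $s - t$ is constant.
   Context: A regular convex cone is a closed convex cone with non-empty interior containing no lines. "Positively curved boundary" means $\partial K\setminus\{0\}$ has everywhere positive curvature (transverse to the rays), so that $\gamma$ is a simple closed strictly convex curve without inflection points. An ellipsoidal cone is the image of the Lorentz cone $\{(x_0,x_1,x_2): x_0 \geq \sqrt{x_1^2+x_2^2}\}$ under an invertible linear map. A $2\pi$-periodic parametrization of $\gamma$ by a real variable $t$ (one period corresponding to one traversal of $\gamma$, orientation-preserving reparametrizations being considered) is called balanced if there exists a $2\pi$-periodic lift $y(t)$ of $\gamma$ to $\partial K\subset\mathbb R^3$ with $\det(y'',y',y)\equiv 1$ which solves $y''' + 2\alpha y' + \alpha' y + \beta y = 0$ for some function $\beta$ and with $\alpha$ a constant. *)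

theory Defs
  imports "HOL-Analysis.Analysis"
begin

fun nderiv :: "nat \<Rightarrow> (real \<Rightarrow> real^3) \<Rightarrow> real \<Rightarrow> real^3" where
  "nderiv 0 y = y"
| "nderiv (Suc n) y = (\<lambda>t. vector_derivative (nderiv n y) (at t))"

definition diff_times :: "nat \<Rightarrow> (real \<Rightarrow> real^3) \<Rightarrow> bool" where
  "diff_times k y \<longleftrightarrow>
     (\<forall>j<k. \<forall>t. (nderiv j y has_vector_derivative nderiv (Suc j) y t) (at t))"

definition Ck :: "nat \<Rightarrow> (real \<Rightarrow> real^3) \<Rightarrow> bool" where
  "Ck k y \<longleftrightarrow> diff_times k y \<and> continuous_on UNIV (nderiv k y)"

definition det3 :: "real^3 \<Rightarrow> real^3 \<Rightarrow> real^3 \<Rightarrow> real" where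
  "det3 a b c = det (vector [a, b, c] :: real^3^3)"

definition periodic2pi :: "(real \<Rightarrow> 'a) \<Rightarrow> bool" where
  "periodic2pi f \<longleftrightarrow> (\<forall>t. f (t + 2 * pi) = f t)"

definition regular_convex_cone :: "(real^3) set \<Rightarrow> bool" where
  "regular_convex_cone K \<longleftrightarrow> closed K \<and> convex K \<and> cone K \<and> interior K \<noteq> {} \<and>
     \<not> (\<exists>a d. d \<noteq> 0 \<and> (\<forall>r::real. a + r *\<^sub>R d \<in> K))"

definition lorentz_cone :: "(real^3) set" where
  "lorentz_cone = {x. x$1 \<ge> sqrt ((x$2)\<^sup>2 + (x$3)\<^sup>2)}"

definition ellipsoidal_cone :: "(real^3) set \<Rightarrow> bool" where
  "ellipsoidal_cone K \<longleftrightarrow>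
     (\<exists>M::real^3^3. invertible M \<and> K = (\<lambda>x. M *v x) ` lorentz_cone)"

text \<open>The boundary of K (minus the apex) is a C^k surface with everywhere positive
  curvature transverse to the rays: equivalently, the projective curve gamma admits a
  C^k 2pi-periodic lift c to the boundary, meeting each boundary ray exactly once per
  period, with det(c'',c',c) nowhere zero (regular, no inflection points).\<close>
definition Ck_pos_curved_boundary :: "nat \<Rightarrow> (real^3) set \<Rightarrow> bool" where
  "Ck_pos_curved_boundary k K \<longleftrightarrow>
     (\<exists>c. Ck k c \<and> periodic2pi c \<and> (\<forall>t. c t \<in> frontier K \<and> c t \<noteq> 0) \<and>
        (\<forall>x \<in> frontier K - {0}. \<exists>!t. t \<in> {0..<2*pi} \<and> (\<exists>r>0. x = r *\<^sub>R c t)) \<and>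
        (\<forall>t. det3 (nderiv 2 c t) (nderiv 1 c t) (c t) \<noteq> 0))"

text \<open>A point of gamma (the projective image of the boundary of the pointed cone K) is a
  boundary ray, represented by its unique unit vector in the boundary of K.
  A 2pi-periodic parametrization of gamma, one period being one traversal.\<close>
definition gamma_param :: "(real^3) set \<Rightarrow> (real \<Rightarrow> real^3) \<Rightarrow> bool" where
  "gamma_param K p \<longleftrightarrow> continuous_on UNIV p \<and> periodic2pi p \<and>
     inj_on p {0..<2*pi} \<and> p ` {0..<2*pi} = frontier K \<inter> sphere 0 1"

text \<open>Balanced: a 2pi-periodic lift y to the boundary of K with det(y'',y',y) = 1 solving
  y''' + 2 alpha y' + alpha' y + beta y = 0 with alpha constant (so alpha' = 0).\<close>
definition balanced :: "(real^3) set \<Rightarrow> (real \<Rightarrow> real^3) \<Rightarrow> bool" where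
  "balanced K p \<longleftrightarrow> gamma_param K p \<and>
     (\<exists>y (\<alpha>::real) (\<beta>::real \<Rightarrow> real).
        diff_times 3 y \<and> periodic2pi y \<and>
        (\<forall>t. y t \<in> frontier K \<and> (\<exists>r. y t = r *\<^sub>R p t)) \<and>
        (\<forall>t. det3 (nderiv 2 y t) (nderiv 1 y t) (y t) = 1) \<and>
        (\<forall>t. nderiv 3 y t + (2 * \<alpha>) *\<^sub>R nderiv 1 y t + \<beta> t *\<^sub>R y t = 0))"

end

theory Submission
  imports Defs
begin

text \<open>
  Let \<open>y\<close> be a balanced lift. The chord function \<open>F(s,t) = det(y(s), y'(t), y(t))\<close> is positive
  off the diagonal by convexity. For fixed \<open>a\<close>, \<open>f = F(\<cdot>,a)\<close> solves the equation of \<open>y\<close> and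
  \<open>g = F(a,\<cdot>)\<close> the adjoint one, so the concomitant \<open>f g'' - f' g' + f'' g + 2\<alpha> f g\<close> is constant,
  and it vanishes because of the double zeros at \<open>a\<close>. This says that the fourth root \<open>\<psi>\<close> of
  \<open>f g\<close> satisfies \<open>\<psi>'' + (\<alpha>/2 + 3n\<^sup>2/16) \<psi> = 0\<close> with \<open>n = f'/f - g'/g\<close>. As \<open>\<psi>\<close> is positive on
  \<open>(a, a + 2\<pi>)\<close> and vanishes at both ends, Sturm comparison with \<open>sin ((t - a)/2)\<close> gives
  \<open>\<alpha> \<le> 1/2\<close>; equality forces \<open>n = 0\<close>, hence \<open>\<beta> = 0\<close>, and then \<open>y\<close> parametrizes an ellipse.
  So \<open>\<alpha> < 1/2\<close> for a non-ellipsoidal cone.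

  If \<open>z\<close> is another balanced lift, then \<open>z(s(t)) = s'(t) y(t)\<close>, and comparing the two equations
  gives \<open>W''' + 2\<alpha> W' = 0\<close> for the periodic function \<open>W = 1/s'\<close>. As \<open>2\<alpha> < 1\<close>, \<open>W\<close> is constant.
\<close>

subsection \<open>Determinants and derivatives\<close>

lemma det3_expand:
  "det3 a b c = a$1 * b$2 * c$3 + a$2 * b$3 * c$1 + a$3 * b$1 * c$2
     - a$1 * b$3 * c$2 - a$2 * b$1 * c$3 - a$3 * b$2 * c$1"
  by (simp add: det3_def det_3)

lemma det3_linear_simps:
  "det3 (a + a') b c = det3 a b c + det3 a' b c"
  "det3 a (b + b') c = det3 a b c + det3 a b' c"
  "det3 a b (c + c') = det3 a b c + det3 a b c'"
  "det3 (a - a') b c = det3 a b c - det3 a' b c"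
  "det3 a (b - b') c = det3 a b c - det3 a b' c"
  "det3 a b (c - c') = det3 a b c - det3 a b c'"
  "det3 (- a) b c = - det3 a b c"
  "det3 a (- b) c = - det3 a b c"
  "det3 a b (- c) = - det3 a b c"
  "det3 (r *\<^sub>R a) b c = r * det3 a b c"
  "det3 a (r *\<^sub>R b) c = r * det3 a b c"
  "det3 a b (r *\<^sub>R c) = r * det3 a b c"
  "det3 a a c = 0" "det3 a b a = 0" "det3 a b b = 0"
  "det3 0 b c = 0" "det3 a 0 c = 0" "det3 a b 0 = 0"
  by (simp_all add: det3_expand algebra_simps)

lemma det3_swap:
  "det3 b a c = - det3 a b c" "det3 a c b = - det3 a b c" "det3 c b a = - det3 a b c"
  by (simp_all add: det3_expand)

text \<open>Cramer's rule multiplied through by the determinant, so that dependent vectors need no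
  separate case.\<close>

lemma det3_cramer:
  "det3 a b c *\<^sub>R x = det3 x b c *\<^sub>R a + det3 a x c *\<^sub>R b + det3 a b x *\<^sub>R c"
  by (simp add: vec_eq_iff forall_3 det3_expand) algebra

lemma has_vector_derivative_nth:
  assumes "(u has_vector_derivative u') (at t)"
  shows "((\<lambda>t. u t $ i) has_real_derivative u' $ i) (at t)"
  using bounded_linear.has_vector_derivative[OF bounded_linear_vec_nth assms]
  by (simp add: has_real_derivative_iff_has_vector_derivative)

lemma DERIV_det3:
  assumes "(u has_vector_derivative u') (at t)" "(v has_vector_derivative v') (at t)"
    "(w has_vector_derivative w') (at t)"
  shows "((\<lambda>t. det3 (u t) (v t) (w t)) has_real_derivative
     det3 u' (v t) (w t) + det3 (u t) v' (w t) + det3 (u t) (v t) w') (at t)"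
proof -
  note [derivative_intros] = assms[THEN has_vector_derivative_nth]
  show ?thesis
    unfolding det3_expand
    by (rule derivative_eq_intros refl)+ (simp add: algebra_simps)
qed

lemma DERIV_inner:
  assumes "(u has_vector_derivative u') (at t)" "(v has_vector_derivative v') (at t)"
  shows "((\<lambda>t. u t \<bullet> v t) has_real_derivative u' \<bullet> v t + u t \<bullet> v') (at t)"
proof -
  have "((\<lambda>t. u t \<bullet> v t) has_vector_derivative u t \<bullet> v' + u' \<bullet> v t) (at t)"
    by (rule bounded_bilinear.has_vector_derivative[OF bounded_bilinear_inner assms])
  then show ?thesis
    by (simp add: has_real_derivative_iff_has_vector_derivative add.commute)
qed

lemma periodic_vector_derivative:
  assumes D: "\<And>t. (f has_vector_derivative f' t) (at t)" and per: "\<And>t. f (t + T) = f t"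
  shows "f' (t + T) = f' t"
proof -
  have "((\<lambda>t. t + T) has_vector_derivative 1) (at t)"
    by (auto intro!: derivative_eq_intros simp: has_real_derivative_iff_has_vector_derivative[symmetric])
  then have "((\<lambda>t. f (t + T)) has_vector_derivative f' (t + T)) (at t)"
    using vector_diff_chain_at[of "\<lambda>t. t + T" 1 t f "f' (t + T)"] D[of "t + T"]
    by (simp add: o_def)
  then show ?thesis
    using D[of t] per vector_derivative_unique_at by auto
qed

lemma periodic_DERIV:
  assumes D: "\<And>t. (f has_real_derivative f' t) (at t)" and per: "\<And>t. f (t + T) = f t"
  shows "f' (t + T) = f' t"
  by (rule periodic_vector_derivative[of f])
    (use assms in \<open>simp_all add: has_real_derivative_iff_has_vector_derivative\<close>)

section \<open>Extrema and double zeros of real functions\<close>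

lemma DERIV_zero_at_global_min:
  assumes "(h has_real_derivative d) (at a)" "\<And>t. h t \<ge> h a"
  shows "d = 0"
  using DERIV_local_min[of h d a 1] assms by auto

text \<open>One application of l'Hopital leaves half the difference quotient of \<open>h1\<close> at
  \<open>a\<close>, so a second derivative at this single point suffices.\<close>

lemma double_zero_quadratic:
  fixes h h1 :: "real \<Rightarrow> real"
  assumes D: "\<And>t. (h has_real_derivative h1 t) (at t)" and D1: "(h1 has_real_derivative c) (at a)"
    and z: "h a = 0" "h1 a = 0"
  shows "((\<lambda>t. h t / (t - a)\<^sup>2) \<longlongrightarrow> c / 2) (at a)"
proof (rule lhopital[where f' = h1 and g' = "\<lambda>t. 2 * (t - a)"])
  have "isCont h a" using D DERIV_isCont by blast
  then show "(h \<longlongrightarrow> 0) (at a)" using z by (simp add: isCont_def)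
  show "((\<lambda>t. (t - a)\<^sup>2) \<longlongrightarrow> 0) (at a)"
    by (auto intro!: tendsto_eq_intros)
  show "\<forall>\<^sub>F t in at a. (t - a)\<^sup>2 \<noteq> 0" "\<forall>\<^sub>F t in at a. 2 * (t - a) \<noteq> 0"
    by (auto simp: eventually_at_filter)
  show "\<forall>\<^sub>F t in at a. (h has_real_derivative h1 t) (at t)" using D by simp
  show "\<forall>\<^sub>F t in at a. ((\<lambda>t. (t - a)\<^sup>2) has_real_derivative 2 * (t - a)) (at t)"
    by (auto intro!: derivative_eq_intros eventuallyI)
  have "((\<lambda>t. (h1 t - h1 a) / (t - a)) \<longlongrightarrow> c) (at a)"
    using D1 by (simp add: has_field_derivative_iff)
  then have "((\<lambda>t. (h1 t - h1 a) / (t - a) / 2) \<longlongrightarrow> c / 2) (at a)"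
    by (intro tendsto_intros) auto
  then show "((\<lambda>t. h1 t / (2 * (t - a))) \<longlongrightarrow> c / 2) (at a)"
    using z by (simp add: mult.commute)
qed

text \<open>Divides the difference quotient of \<open>h1\<close> by the quadratic limit. The residue
  2 of the logarithmic derivative controls the Sturm Wronskian at the ends of the period.\<close>

lemma double_zero_log_derivative:
  fixes h h1 :: "real \<Rightarrow> real"
  assumes D: "\<And>t. (h has_real_derivative h1 t) (at t)" and D1: "(h1 has_real_derivative c) (at a)"
    and z: "h a = 0" "h1 a = 0" and c: "c \<noteq> 0"
  shows "((\<lambda>t. h1 t / h t * (t - a)) \<longlongrightarrow> 2) (at a)"
proof -
  have "((\<lambda>t. (h1 t - h1 a) / (t - a)) \<longlongrightarrow> c) (at a)"
    using D1 by (simp add: has_field_derivative_iff)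
  then have "((\<lambda>t. (h1 t - h1 a) / (t - a) / (h t / (t - a)\<^sup>2)) \<longlongrightarrow> c / (c / 2)) (at a)"
    by (rule tendsto_divide[OF _ double_zero_quadratic[OF D D1 z]]) (use c in simp)
  then have "((\<lambda>t. (h1 t - h1 a) / (t - a) / (h t / (t - a)\<^sup>2)) \<longlongrightarrow> 2) (at a)"
    using c by simp
  then show ?thesis
    by (rule Lim_transform_eventually)
      (use z in \<open>simp add: eventually_at_filter power2_eq_square\<close>)
qed

lemma second_derivative_nonneg_at_min:
  fixes h h1 :: "real \<Rightarrow> real"
  assumes D: "\<And>t. (h has_real_derivative h1 t) (at t)" and D1: "(h1 has_real_derivative c) (at a)"
    and z: "h a = 0" and nonneg: "\<And>t. h t \<ge> 0"
  shows "c \<ge> 0"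
proof -
  have "h1 a = 0"
    using DERIV_zero_at_global_min[OF D] z nonneg by metis
  from tendsto_lowerbound[OF double_zero_quadratic[OF D D1 z this], of 0] nonneg
  show ?thesis by simp
qed

lemma simple_zero_quotient:
  assumes "(S has_real_derivative d) (at a)" "S a = (0::real)"
  shows "((\<lambda>t. S t / (t - a)) \<longlongrightarrow> d) (at a)"
  using assms by (simp add: has_field_derivative_iff)

lemma zero_vector_derivative_imp_constant:
  fixes h :: "real \<Rightarrow> 'a::real_normed_vector"
  assumes "\<And>t. (h has_vector_derivative 0) (at t)"
  shows "h t = h 0"
  using has_vector_derivative_zero_constant[of UNIV h] assms by (metis UNIV_I convex_UNIV)

text \<open>The chain rule read backwards, for an \<open>s\<close> known only to be continuous: the
  Caratheodory factors of \<open>R\<close> and of the composition have the difference quotient of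
  \<open>s\<close> as their quotient.\<close>

lemma DERIV_of_DERIV_compose:
  fixes R s :: "real \<Rightarrow> real"
  assumes R: "(R has_real_derivative D) (at (s t))" and D: "D \<noteq> 0" and s: "isCont s t"
    and Rs: "((\<lambda>x. R (s x)) has_real_derivative E) (at t)"
  shows "(s has_real_derivative E / D) (at t)"
proof -
  from R obtain k where k: "\<And>x. R x - R (s t) = k x * (x - s t)" "isCont k (s t)" "k (s t) = D"
    unfolding CARAT_DERIV by blast
  from Rs obtain e where e: "\<And>x. R (s x) - R (s t) = e x * (x - t)" "isCont e t" "e t = E"
    unfolding CARAT_DERIV by blast
  have "isCont (\<lambda>x. k (s x)) t"
    using s k(2) by (rule isCont_o2)
  then have ks: "((\<lambda>x. k (s x)) \<longlongrightarrow> D) (at t)"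
    using k(3) by (simp add: isCont_def)
  have "((\<lambda>x. e x / k (s x)) \<longlongrightarrow> E / D) (at t)"
    using e(2,3) ks D by (intro tendsto_divide) (auto simp: isCont_def)
  moreover have "\<forall>\<^sub>F x in at t. e x / k (s x) = (s x - s t) / (x - t)"
    using tendsto_imp_eventually_ne[OF ks D] eventually_neq_at_within[of t t UNIV]
  proof eventually_elim
    case (elim x)
    have "k (s x) * (s x - s t) = e x * (x - t)" using k(1)[of "s x"] e(1)[of x] by simp
    then show ?case using elim by (simp add: field_simps)
  qed
  ultimately show ?thesis
    unfolding has_field_derivative_iff by (rule Lim_transform_eventually)
qed

lemma inner_ratio_differentiable:
  fixes w y :: "real \<Rightarrow> real^3"
  assumes "(w has_vector_derivative w') (at t)" "(y has_vector_derivative y') (at t)" "y t \<noteq> 0"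
  shows "\<exists>d. ((\<lambda>t. (w t \<bullet> y t) / (y t \<bullet> y t)) has_real_derivative d) (at t)"
  using DERIV_divide[OF DERIV_inner[OF assms(1,2)] DERIV_inner[OF assms(2,2)]] assms(3)
  by auto

lemma cube_eq_imp_eq:
  fixes u v :: real
  assumes "u ^ 3 = v ^ 3" "v > 0"
  shows "u = v"
proof -
  have "(u - v) * ((u + v / 2)\<^sup>2 + 3 / 4 * v\<^sup>2) = 0"
    using assms(1) by (simp add: power2_eq_square power3_eq_cube field_simps)
  moreover have "(u + v / 2)\<^sup>2 + 3 / 4 * v\<^sup>2 > 0"
    using assms(2) by (intro add_nonneg_pos) auto
  ultimately show ?thesis by simp
qed

subsection \<open>Periodic functions and closed curves\<close>

lemma periodic2pi_int:
  assumes "periodic2pi q"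
  shows "q (t + 2 * pi * of_int k) = q t"
proof -
  have nat: "q (t + 2 * pi * of_nat m) = q t" for m t
  proof (induction m)
    case (Suc m)
    have "q (t + 2 * pi * of_nat (Suc m)) = q ((t + 2 * pi * of_nat m) + 2 * pi)"
      by (simp add: algebra_simps)
    then show ?case using assms Suc by (simp add: periodic2pi_def)
  qed simp
  show ?thesis
  proof (cases "k \<ge> 0")
    case True then show ?thesis using nat[of t "nat k"] by simp
  next
    case False then show ?thesis using nat[of "t + 2 * pi * of_int k" "nat (- k)"] by simp
  qed
qed

lemma periodic2pi_representative:
  assumes "periodic2pi q"
  obtains t' k where "t' \<in> {0..<2 * pi}" "t = t' + 2 * pi * of_int k" "q t = q t'"
proof -
  define k where "k = \<lfloor>t / (2 * pi)\<rfloor>"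
  define t' where "t' = t - 2 * pi * of_int k"
  have "of_int k \<le> t / (2 * pi)" "t / (2 * pi) < of_int k + 1"
    unfolding k_def by linarith+
  then have "t' \<in> {0..<2 * pi}" by (auto simp: t'_def field_simps)
  moreover have t: "t = t' + 2 * pi * of_int k" by (simp add: t'_def)
  moreover have "q t = q t'" by (subst t) (rule periodic2pi_int[OF assms])
  ultimately show thesis by (rule that)
qed

lemma periodic2pi_inj_eq:
  assumes per: "periodic2pi q" and inj: "inj_on q {0..<2 * pi}" and eq: "q s = q t"
  shows "\<exists>k::int. s = t + 2 * pi * k"
proof -
  obtain s' k where s: "s' \<in> {0..<2 * pi}" "s = s' + 2 * pi * of_int k" "q s = q s'"
    using periodic2pi_representative[OF per] by metis
  obtain t' m where t: "t' \<in> {0..<2 * pi}" "t = t' + 2 * pi * of_int m" "q t = q t'"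
    using periodic2pi_representative[OF per] by metis
  have "s' = t'" using inj s t eq by (auto simp: inj_on_def)
  then show ?thesis using s t by (intro exI[of _ "k - m"]) (simp add: algebra_simps)
qed

text \<open>The inverse of \<open>q\<close>, taken as a map to the unit circle, is continuous on the
  compact curve. Composed with \<open>p\<close> it has a continuous logarithm on the contractible
  line, whose imaginary part is \<open>s\<close>.\<close>

lemma closed_curve_lift:
  fixes p q :: "real \<Rightarrow> 'a::euclidean_space"
  assumes q: "continuous_on UNIV q" "periodic2pi q" "inj_on q {0..<2 * pi}"
    and p: "continuous_on UNIV p" "\<And>t. p t \<in> range q"
  obtains s where "continuous_on UNIV s" "\<And>t. p t = q (s t)"
proof -
  \<comment> \<open>The chosen parameter is determined only up to multiples of 2 pi, which
    \<open>cis\<close> does not see.\<close>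
  define E where "E x = cis (SOME \<sigma>. q \<sigma> = x)" for x
  have E: "E (q \<sigma>) = cis \<sigma>" for \<sigma>
  proof -
    have "q (SOME \<sigma>'. q \<sigma>' = q \<sigma>) = q \<sigma>" by (rule someI) simp
    then obtain k :: int where "(SOME \<sigma>'. q \<sigma>' = q \<sigma>) = \<sigma> + 2 * pi * k"
      using periodic2pi_inj_eq[OF q(2,3)] by blast
    then show ?thesis by (simp add: E_def cis_mult[symmetric] cis_multiple_2pi)
  qed
  have rq: "range q = q ` {0..2 * pi}"
  proof (intro equalityI subsetI)
    fix x assume "x \<in> range q"
    then obtain t where "x = q t" by blast
    then show "x \<in> q ` {0..2 * pi}"
      using periodic2pi_representative[OF q(2), of t] by (metis atLeastLessThan_iff atLeastAtMost_iff image_eqI less_imp_le)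
  qed auto
  have "compact (range q)"
    unfolding rq by (intro compact_continuous_image compact_Icc continuous_on_subset[OF q(1)]) simp
  have "continuous_on (range q) E"
    unfolding continuous_on_closed_vimage[OF compact_imp_closed[OF \<open>compact (range q)\<close>]]
  proof (intro allI impI)
    fix B :: "complex set" assume B: "closed B"
    \<comment> \<open>Preimages under \<open>E\<close> are images under \<open>q\<close> of compact
      sets of parameters, hence closed.\<close>
    have "E -` B \<inter> range q = q ` ({0..2 * pi} \<inter> cis -` B)"
      unfolding rq by (auto simp: E)
    moreover have "compact ({0..2 * pi} \<inter> cis -` B)"
      by (intro compact_Int_closed compact_Icc closed_vimage B continuous_intros)
    ultimately show "closed (E -` B \<inter> range q)"
      by (metis compact_continuous_image compact_imp_closed continuous_on_subset q(1) subset_UNIV)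
  qed
  then have "continuous_on UNIV (\<lambda>t. E (p t))"
    by (rule continuous_on_compose2[OF _ p(1)]) (use p(2) in auto)
  moreover have Ep: "E (p t) \<noteq> 0" for t
    using p(2)[of t] E by auto
  ultimately obtain g where g: "continuous_on UNIV g" "\<And>t. E (p t) = exp (g t)"
    using continuous_logarithm_on_contractible[of UNIV "\<lambda>t. E (p t)"]
    by (metis UNIV_I contractible_UNIV)
  show thesis
  proof (rule that[of "\<lambda>t. Im (g t)"])
    show "continuous_on UNIV (\<lambda>t. Im (g t))" by (intro continuous_intros g)
    fix t
    obtain \<sigma> where \<sigma>: "p t = q \<sigma>" using p(2)[of t] by auto
    have e: "cis \<sigma> = exp (g t)" using g(2)[of t] E \<sigma> by simp
    then have "exp (Re (g t)) = 1" by (metis norm_cis norm_exp_eq_Re)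
    then have "cis \<sigma> = cis (Im (g t))"
      using e exp_eq_polar[of "g t"] by simp
    then obtain k :: int where "\<sigma> = Im (g t) + 2 * pi * k"
      using sin_cos_eq_iff[of \<sigma> "Im (g t)"] by (auto simp: complex_eq_iff)
    then show "p t = q (Im (g t))"
      using \<sigma> periodic2pi_int[OF q(2)] by simp
  qed
qed

text \<open>For \<open>c \<le> 0\<close> the periodic product of \<open>V\<close> and
  \<open>V1\<close> is monotone, hence constant; this makes \<open>V\<close> constant, and a
  periodic \<open>W\<close> has no nonzero constant slope. For \<open>0 < c < 1\<close> the vector
  (\<omega> V, V1) turns by the angle 2 pi \<omega> over a period, and such a rotation fixes no
  nonzero vector.\<close>

lemma periodic_hill_constant:
  fixes W V V1 :: "real \<Rightarrow> real"
  assumes W: "\<And>t. (W has_real_derivative V t) (at t)"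
    and V: "\<And>t. (V has_real_derivative V1 t) (at t)"
    and V1: "\<And>t. (V1 has_real_derivative - c * V t) (at t)"
    and per: "\<And>t. W (t + 2 * pi) = W t" and c: "c < 1"
  shows "V t = 0"
proof -
  have perV: "V (t + 2 * pi) = V t" for t by (rule periodic_DERIV[OF W per])
  have perV1: "V1 (t + 2 * pi) = V1 t" for t by (rule periodic_DERIV[OF V perV])
  show ?thesis
  proof (cases "c \<le> 0")
    case True
    let ?P = "\<lambda>t. V t * V1 t"
    have D: "(?P has_real_derivative (V1 x)\<^sup>2 - c * (V x)\<^sup>2) (at x)" for x
      using DERIV_mult[OF V V1, of x] by (simp add: power2_eq_square algebra_simps)
    have nonneg: "(V1 x)\<^sup>2 - c * (V x)\<^sup>2 \<ge> 0" for x
      using True by (simp add: mult_nonpos_nonneg order.trans[of _ 0])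
    have mono: "?P a \<le> ?P b" if "a \<le> b" for a b
      using that D nonneg by (intro DERIV_nonneg_imp_nondecreasing[of a b ?P]) blast+
    have const: "?P x = ?P 0" for x
    proof -
      obtain x' k where x': "x' \<in> {0..<2 * pi}" "?P x = ?P x'"
        using periodic2pi_representative[of ?P x] perV perV1 unfolding periodic2pi_def by metis
      moreover have "?P (2 * pi) = ?P 0" using perV[of 0] perV1[of 0] by simp
      ultimately show ?thesis using mono[of 0 x'] mono[of x' "2 * pi"] by auto
    qed
    have "((\<lambda>_. ?P 0) has_real_derivative (V1 x)\<^sup>2 - c * (V x)\<^sup>2) (at x)" for x
      using D[of x] by (rule has_field_derivative_transform_within_open[where S = UNIV]) (use const in auto)
    then have "(V1 x)\<^sup>2 - c * (V x)\<^sup>2 = 0" for x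
      using DERIV_unique DERIV_const by blast
    moreover have "- c * (V x)\<^sup>2 \<ge> 0" for x using True by (simp add: mult_nonpos_nonneg)
    ultimately have "(V1 x)\<^sup>2 = 0" for x
      by (smt (verit) zero_le_power2 mult_minus_left)
    then have "V1 x = 0" for x by simp
    then have cV: "V x = V t" for x
      using DERIV_isconst_all[of V] V by metis
    have "((\<lambda>x. W x - V t * x) has_real_derivative V x - V t) (at x)" for x
      by (auto intro!: derivative_eq_intros W)
    then have "W (2 * pi) - V t * (2 * pi) = W 0 - V t * 0"
      using DERIV_isconst_all[of "\<lambda>x. W x - V t * x"] cV by (metis diff_self)
    then show ?thesis using per[of 0] by simp
  next
    case False
    define \<omega> where "\<omega> = sqrt c"
    have \<omega>: "0 < \<omega>" "\<omega> < 1" "c = \<omega> * \<omega>" using False c by (auto simp: \<omega>_def)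
    \<comment> \<open>The components of (\<omega> V, V1) turned by the angle \<omega> x, which
      undoes the flow.\<close>
    let ?A = "\<lambda>x. \<omega> * V x * cos (\<omega> * x) - V1 x * sin (\<omega> * x)"
    let ?B = "\<lambda>x. \<omega> * V x * sin (\<omega> * x) + V1 x * cos (\<omega> * x)"
    note [derivative_intros] = V V1
    have "(?A has_real_derivative 0) (at x)" for x
      by (auto intro!: derivative_eq_intros simp: \<omega>(3) algebra_simps)
    then have A: "?A x = \<omega> * V 0" for x
      using DERIV_isconst_all[of ?A] by (metis (no_types, lifting) cos_zero sin_zero mult_zero_right diff_zero mult.right_neutral)
    have "(?B has_real_derivative 0) (at x)" for x
      by (auto intro!: derivative_eq_intros simp: \<omega>(3) algebra_simps)
    then have B: "?B x = V1 0" for x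
      using DERIV_isconst_all[of ?B] by (metis (no_types, lifting) cos_zero sin_zero mult_zero_right add_0 mult.right_neutral)
    have "V (2 * pi) = V 0" "V1 (2 * pi) = V1 0" using perV[of 0] perV1[of 0] by simp_all
    define C where "C = cos (\<omega> * (2 * pi))"
    define S where "S = sin (\<omega> * (2 * pi))"
    have a: "\<omega> * V 0 * C - V1 0 * S = \<omega> * V 0" and b: "\<omega> * V 0 * S + V1 0 * C = V1 0"
      using A[of "2 * pi"] B[of "2 * pi"] \<open>V (2 * pi) = V 0\<close> \<open>V1 (2 * pi) = V1 0\<close>
      by (simp_all add: C_def S_def)
    \<comment> \<open>Scalar product of the initial vector (\<omega> V, V1) with its rotated
      image.\<close>
    have "(1 - C) * ((\<omega> * V 0)\<^sup>2 + (V1 0)\<^sup>2) = 0"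
      using a b by algebra
    moreover have "C \<noteq> 1"
    proof
      assume "C = 1"
      then obtain k :: int where "\<omega> * (2 * pi) = real_of_int k * 2 * pi"
        unfolding C_def cos_one_2pi_int by blast
      then have "\<omega> = k" by simp
      then show False using \<omega>(1,2) by simp
    qed
    ultimately have "V 0 = 0 \<and> V1 0 = 0" using \<omega>(1) by (simp add: sum_power2_eq_zero_iff)
    then have "?A t = 0" "?B t = 0" using A[of t] B[of t] by simp_all
    moreover have "\<omega> * V t = ?A t * cos (\<omega> * t) + ?B t * sin (\<omega> * t)"
    proof -
      have "(w * v * C - v' * S) * C + (w * v * S + v' * C) * S = w * v * (S\<^sup>2 + C\<^sup>2)" for w v v' C S :: real
        by (simp add: power2_eq_square algebra_simps)
      from this[of \<omega> "V t" "cos (\<omega> * t)" "V1 t" "sin (\<omega> * t)"] show ?thesis by simp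
    qed
    ultimately show ?thesis using \<omega>(1) by simp
  qed
qed

subsection \<open>Convexity of balanced lifts\<close>

text \<open>The third order equation is encoded as the derivative of \<open>y2\<close>. As
  \<open>r\<close> is an arbitrary real in \<open>inj_mod_period\<close>, a line through 0 is met at
  most once per period.\<close>

locale balanced_lift =
  fixes K :: "(real^3) set" and y y1 y2 :: "real \<Rightarrow> real^3" and \<alpha> :: real and \<beta> :: "real \<Rightarrow> real"
  assumes cone: "regular_convex_cone K"
    and lift_in_frontier: "y t \<in> frontier K"
    and periodic: "y (t + 2 * pi) = y t"
    and unit_det: "det3 (y2 t) (y1 t) (y t) = 1"
    and deriv_y: "(y has_vector_derivative y1 t) (at t)"
    and deriv_y1: "(y1 has_vector_derivative y2 t) (at t)"
    and deriv_y2: "(y2 has_vector_derivative - (2 * \<alpha>) *\<^sub>R y1 t - \<beta> t *\<^sub>R y t) (at t)"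
    and inj_mod_period: "y s = r *\<^sub>R y t \<Longrightarrow> \<exists>k::int. s = t + 2 * pi * k"
begin

lemma closed_K: "closed K" and convex_K: "convex K" and cone_K: "cone K"
  using cone by (auto simp: regular_convex_cone_def)

lemma lift_in_K: "y t \<in> K"
  using lift_in_frontier[of t] closed_K by (simp add: frontier_def)

lemma scale_in_K: "x \<in> K \<Longrightarrow> r \<ge> 0 \<Longrightarrow> r *\<^sub>R x \<in> K"
  using cone_K by (simp add: cone_def)

lemma lift_nonzero: "y t \<noteq> 0"
  using unit_det[of t] by (auto simp: det3_linear_simps)

lemma periodic_y1: "y1 (t + 2 * pi) = y1 t"
  by (rule periodic_vector_derivative[OF deriv_y periodic])

lemma periodic_y2: "y2 (t + 2 * pi) = y2 t"
  by (rule periodic_vector_derivative[OF deriv_y1 periodic_y1])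

text \<open>The moving frame has determinant 1, so Cramer's rule has no denominators. The first
  coordinate vanishes exactly on the tangent plane along the ray of \<open>y t\<close>.\<close>

lemma frame_expansion:
  "x = det3 x (y1 t) (y t) *\<^sub>R y2 t + det3 (y2 t) x (y t) *\<^sub>R y1 t + det3 (y2 t) (y1 t) x *\<^sub>R y t"
  using det3_cramer[of "y2 t" "y1 t" "y t" x] by (simp add: unit_det)

text \<open>A supporting functional \<open>a\<close> at \<open>y t\<close> vanishes there and is
  minimal along the curve, so it also kills \<open>y1 t\<close>. Hence it is a multiple of this
  determinant, with a factor \<open>a \<bullet> y2 t\<close> that the second derivative shows to be
  positive.\<close>

lemma tangent_plane_supports:
  assumes x: "x \<in> K"
  shows "det3 x (y1 t) (y t) \<ge> 0"
proof -
  have "y t \<notin> rel_interior K"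
    using lift_in_frontier[of t] rel_interior_nonempty_interior[of K] cone
    by (simp add: frontier_def regular_convex_cone_def)
  then obtain a where a: "\<And>v. v \<in> closure K \<Longrightarrow> a \<bullet> y t \<le> a \<bullet> v"
    and strict: "\<And>v. v \<in> rel_interior K \<Longrightarrow> a \<bullet> y t < a \<bullet> v"
    using supporting_hyperplane_rel_boundary[OF convex_K lift_in_K[of t]]
    by (metis closure_closed closed_K)
  have a: "a \<bullet> y t \<le> a \<bullet> v" if "v \<in> K" for v
    using a that closed_K by simp
  have az: "a \<noteq> 0"
  proof
    assume "a = 0"
    then have "rel_interior K = {}" using strict by auto
    then show False
      using rel_interior_eq_empty[OF convex_K] x by auto
  qed
  \<comment> \<open>Multiples of \<open>y t\<close> by 0 and 2 stay in the cone, so the supporting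
    plane passes through the apex.\<close>
  have "a \<bullet> y t \<le> 0"
    using a[OF scale_in_K[OF lift_in_K[of t], of 0]] by simp
  moreover have "a \<bullet> y t \<ge> 0"
    using a[OF scale_in_K[OF lift_in_K[of t], of 2]] by simp
  ultimately have a0: "a \<bullet> y t = 0" by simp
  have D: "((\<lambda>s. a \<bullet> y s) has_real_derivative a \<bullet> y1 s) (at s)" for s
    using DERIV_inner[OF has_vector_derivative_const deriv_y] by simp
  have D1: "((\<lambda>s. a \<bullet> y1 s) has_real_derivative a \<bullet> y2 t) (at t)"
    using DERIV_inner[OF has_vector_derivative_const deriv_y1] by simp
  have nonneg: "a \<bullet> y s \<ge> 0" for s
    using a[OF lift_in_K[of s]] a0 by simp
  have a1: "a \<bullet> y1 t = 0"
    using DERIV_zero_at_global_min[OF D] nonneg a0 by metis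
  have ax: "a \<bullet> v = det3 v (y1 t) (y t) * (a \<bullet> y2 t)" for v
    using arg_cong[OF frame_expansion[of v t], of "\<lambda>v. a \<bullet> v"] a0 a1
    by (simp add: inner_add_right)
  have "a \<bullet> y2 t \<ge> 0"
    by (rule second_derivative_nonneg_at_min[OF D D1 a0 nonneg])
  \<comment> \<open>Otherwise \<open>a \<bullet> a\<close> would vanish.\<close>
  moreover have "a \<bullet> y2 t \<noteq> 0"
    using ax[of a] az by auto
  ultimately have "a \<bullet> y2 t > 0" by simp
  moreover have "a \<bullet> x \<ge> 0" using a[OF x] a0 by simp
  ultimately show ?thesis
    using ax[of x] by (simp add: zero_le_mult_iff)
qed

lemma chord_nonneg: "det3 (y s) (y1 t) (y t) \<ge> 0"
  by (rule tangent_plane_supports[OF lift_in_K])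

lemma chord_zero_imp:
  assumes "det3 (y s) (y1 t) (y t) = 0"
  shows "\<exists>k::int. s = t + 2 * pi * k"
proof -
  \<comment> \<open>The zero is a minimum in \<open>t\<close> as well, which puts \<open>y s\<close> into two planes meeting in the line of \<open>y t\<close>.\<close>
  have "((\<lambda>t. det3 (y s) (y1 t) (y t)) has_real_derivative det3 (y s) (y2 t) (y t)) (at t)"
    using DERIV_det3[OF has_vector_derivative_const deriv_y1 deriv_y, of "y s" t]
    by (simp add: det3_linear_simps)
  then have "det3 (y s) (y2 t) (y t) = 0"
    by (rule DERIV_zero_at_global_min) (use assms chord_nonneg in auto)
  then have "det3 (y2 t) (y s) (y t) = 0"
    using det3_swap by (metis neg_equal_0_iff_equal)
  then have "y s = det3 (y2 t) (y1 t) (y s) *\<^sub>R y t"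
    using frame_expansion[of "y s" t] assms by simp
  then show ?thesis by (rule inj_mod_period)
qed

lemma chord_pos:
  assumes "0 < \<bar>s - t\<bar>" "\<bar>s - t\<bar> < 2 * pi"
  shows "det3 (y s) (y1 t) (y t) > 0"
proof (rule ccontr)
  assume "\<not> ?thesis"
  then obtain k :: int where k: "s = t + 2 * pi * k"
    using chord_zero_imp chord_nonneg[of s t] by (metis less_eq_real_def)
  then have "\<bar>s - t\<bar> = 2 * pi * \<bar>real_of_int k\<bar>" by (simp add: abs_mult)
  with assms have "\<bar>real_of_int k\<bar> < 1" "k \<noteq> 0" by auto
  then show False by linarith
qed

subsection \<open>Sturm comparison\<close>

definition f :: "real \<Rightarrow> real \<Rightarrow> real" where "f a t = det3 (y t) (y1 a) (y a)"
definition f1 :: "real \<Rightarrow> real \<Rightarrow> real" where "f1 a t = det3 (y1 t) (y1 a) (y a)"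
definition f2 :: "real \<Rightarrow> real \<Rightarrow> real" where "f2 a t = det3 (y2 t) (y1 a) (y a)"
definition g :: "real \<Rightarrow> real \<Rightarrow> real" where "g a t = det3 (y a) (y1 t) (y t)"
definition g1 :: "real \<Rightarrow> real \<Rightarrow> real" where "g1 a t = det3 (y a) (y2 t) (y t)"
text \<open>The third derivative of \<open>y\<close>, which enters when \<open>g1\<close> is
  differentiated, is eliminated through the equation; its \<beta> term drops out.\<close>

definition g2 :: "real \<Rightarrow> real \<Rightarrow> real"
  where "g2 a t = det3 (y a) (y2 t) (y1 t) - 2 * \<alpha> * g a t"

lemma DERIV_f: "(f a has_real_derivative f1 a t) (at t)"
  using DERIV_det3[OF deriv_y has_vector_derivative_const has_vector_derivative_const, where t = t]
  by (simp add: f_def[abs_def] f1_def det3_linear_simps)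

lemma DERIV_f1: "(f1 a has_real_derivative f2 a t) (at t)"
  using DERIV_det3[OF deriv_y1 has_vector_derivative_const has_vector_derivative_const, where t = t]
  by (simp add: f1_def[abs_def] f2_def det3_linear_simps)

lemma DERIV_f2: "(f2 a has_real_derivative - (2 * \<alpha>) * f1 a t - \<beta> t * f a t) (at t)"
  using DERIV_det3[OF deriv_y2 has_vector_derivative_const has_vector_derivative_const, where t = t]
  by (simp add: f_def f1_def f2_def[abs_def] det3_linear_simps)

lemma DERIV_g: "(g a has_real_derivative g1 a t) (at t)"
  using DERIV_det3[OF has_vector_derivative_const deriv_y1 deriv_y, where t = t]
  by (simp add: g_def[abs_def] g1_def det3_linear_simps)

lemma DERIV_g1: "(g1 a has_real_derivative g2 a t) (at t)"
  using DERIV_det3[OF has_vector_derivative_const deriv_y2 deriv_y, where t = t]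
  by (simp add: g1_def[abs_def] g2_def g_def det3_linear_simps)

text \<open>The sign of \<beta> is opposite to that in \<open>DERIV_f2\<close>, as befits the
  adjoint equation; this lets \<beta> cancel in the concomitant.\<close>

lemma DERIV_g2: "(g2 a has_real_derivative - (2 * \<alpha>) * g1 a t + \<beta> t * g a t) (at t)"
proof -
  have "((\<lambda>t. det3 (y a) (y2 t) (y1 t)) has_real_derivative \<beta> t * g a t) (at t)"
    using DERIV_det3[OF has_vector_derivative_const deriv_y2 deriv_y1, of "y a" t]
    by (simp add: g_def det3_linear_simps det3_swap(2)[of "y a" "y1 t" "y t"])
  from DERIV_diff[OF this DERIV_cmult[OF DERIV_g[of a t], of "2 * \<alpha>"]]
  show ?thesis by (simp add: g2_def[abs_def])
qed

lemma periodic_fg: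
  "f a (t + 2 * pi) = f a t" "f1 a (t + 2 * pi) = f1 a t" "f2 a (t + 2 * pi) = f2 a t"
  "g a (t + 2 * pi) = g a t" "g1 a (t + 2 * pi) = g1 a t" "g2 a (t + 2 * pi) = g2 a t"
  by (simp_all add: f_def f1_def f2_def g_def g1_def g2_def periodic periodic_y1 periodic_y2)

lemma double_zero_fg:
  "f a a = 0" "f1 a a = 0" "f2 a a = 1" "g a a = 0" "g1 a a = 0" "g2 a a = 1"
  using unit_det[of a]
  by (simp_all add: f_def f1_def f2_def g_def g1_def g2_def det3_linear_simps)
     (simp add: det3_expand algebra_simps)

lemma fg_pos:
  assumes "a < t" "t < a + 2 * pi"
  shows "f a t > 0" "g a t > 0"
  using chord_pos[of t a] chord_pos[of a t] assms by (auto simp: f_def g_def)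

lemma bilinear_concomitant_zero:
  "f a t * g2 a t - f1 a t * g1 a t + f2 a t * g a t + 2 * \<alpha> * f a t * g a t = 0"
proof -
  let ?C = "\<lambda>t. f a t * g2 a t - f1 a t * g1 a t + f2 a t * g a t + 2 * \<alpha> * f a t * g a t"
  note [derivative_intros] = DERIV_f DERIV_f1 DERIV_f2 DERIV_g DERIV_g1 DERIV_g2
  have "(?C has_real_derivative 0) (at t)" for t
    by (rule derivative_eq_intros refl)+ (simp add: algebra_simps)
  then have "?C t = ?C a"
    by (rule DERIV_isconst_all[rule_format]) 
  then show ?thesis by (simp add: double_zero_fg)
qed

text \<open>Here \<open>r = \<psi>'/\<psi>\<close>, and \<open>sturm_wronskian\<close> is the Wronskian of \<open>\<psi>\<close> and \<open>sin ((t - a)/2)\<close>. At the end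
  points of the period \<open>r\<close> has the junk value \<open>0\<close>, which is harmless because \<open>\<psi>\<close> vanishes there.\<close>

definition r :: "real \<Rightarrow> real \<Rightarrow> real" where "r a t = (f1 a t / f a t + g1 a t / g a t) / 4"
definition n :: "real \<Rightarrow> real \<Rightarrow> real" where "n a t = f1 a t / f a t - g1 a t / g a t"
definition \<psi> :: "real \<Rightarrow> real \<Rightarrow> real" where "\<psi> a t = sqrt (sqrt (f a t * g a t))"
definition sturm_wronskian :: "real \<Rightarrow> real \<Rightarrow> real" where
  "sturm_wronskian a t = \<psi> a t * (r a t * sin ((t - a) / 2) - cos ((t - a) / 2) / 2)"

text \<open>Riccati form of the equation for \<psi>. Dividing the vanishing concomitant by f g
  expresses f''/f + g''/g through the logarithmic derivatives.\<close>

lemma DERIV_r: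
  assumes "a < t" "t < a + 2 * pi"
  shows "(r a has_real_derivative - (r a t)\<^sup>2 - \<alpha> / 2 - 3 * (n a t)\<^sup>2 / 16) (at t)"
proof -
  note pos = fg_pos[OF assms]
  \<comment> \<open>Rests on w^2 - w v + v^2 = (w + v)^2/4 + 3 (w - v)^2/4; division by 4 yields the
    constant 3/16.\<close>
  have riccati: "(A - w\<^sup>2 + (B - v\<^sup>2)) / 4 = - ((w + v) / 4)\<^sup>2 - \<alpha> / 2 - 3 * (w - v)\<^sup>2 / 16"
    if "A + B = w * v - 2 * \<alpha>" for A B w v
  proof -
    have "A = w * v - 2 * \<alpha> - B" using that by simp
    then show ?thesis by (simp add: power2_eq_square field_simps)
  qed
  have D: "(r a has_real_derivative
     ((f2 a t * f a t - f1 a t * f1 a t) / (f a t * f a t)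
      + (g2 a t * g a t - g1 a t * g1 a t) / (g a t * g a t)) / 4) (at t)"
    unfolding r_def[abs_def]
    using pos by (intro DERIV_cdivide DERIV_add DERIV_divide DERIV_f DERIV_f1 DERIV_g DERIV_g1) auto
  have "f2 a t / f a t + g2 a t / g a t = (f1 a t / f a t) * (g1 a t / g a t) - 2 * \<alpha>"
    using bilinear_concomitant_zero[of a t] pos by (simp add: field_simps)
  moreover have "(f2 a t * f a t - f1 a t * f1 a t) / (f a t * f a t) = f2 a t / f a t - (f1 a t / f a t)\<^sup>2"
    "(g2 a t * g a t - g1 a t * g1 a t) / (g a t * g a t) = g2 a t / g a t - (g1 a t / g a t)\<^sup>2"
    using pos by (simp_all add: field_simps power2_eq_square)
  ultimately have "((f2 a t * f a t - f1 a t * f1 a t) / (f a t * f a t)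
      + (g2 a t * g a t - g1 a t * g1 a t) / (g a t * g a t)) / 4
     = - (r a t)\<^sup>2 - \<alpha> / 2 - 3 * (n a t)\<^sup>2 / 16"
    unfolding r_def n_def using riccati by presburger
  with D show ?thesis by simp
qed

lemma DERIV_\<psi>:
  assumes "a < t" "t < a + 2 * pi"
  shows "(\<psi> a has_real_derivative r a t * \<psi> a t) (at t)"
proof -
  note pos = fg_pos[OF assms]
  define P where "P = f a t * g a t"
  \<comment> \<open>With \<open>P = s^4\<close> the nested roots become rational in
    \<open>s\<close>.\<close>
  define s where "s = sqrt (sqrt P)"
  have P: "P > 0" using pos by (simp add: P_def)
  then have s: "s > 0" and s2: "sqrt P = s^2" by (simp_all add: s_def)
  have "P = (sqrt P)^2" using P by simp
  then have s4: "P = s^4" by (simp add: s2)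
  have D: "(\<psi> a has_real_derivative
      inverse s / 2 * (inverse (sqrt P) / 2 * (f1 a t * g a t + g1 a t * f a t))) (at t)"
    unfolding \<psi>_def[abs_def] P_def s_def
    using pos by (intro DERIV_chain2[OF DERIV_real_sqrt] DERIV_mult DERIV_f DERIV_g) auto
  have "f1 a t * g a t + g1 a t * f a t = 4 * r a t * P"
    using pos by (simp add: r_def P_def field_simps)
  then have "inverse s / 2 * (inverse (sqrt P) / 2 * (f1 a t * g a t + g1 a t * f a t)) = r a t * s"
    using s by (simp add: s2) (simp add: s4 field_simps power2_eq_square power4_eq_xxxx)
  with D show ?thesis by (simp add: \<psi>_def s_def P_def)
qed

text \<open>The Wronskian of solutions of two equations u'' + c u = 0 changes at the rate of the
  difference of the coefficients times the product. Here c is \<alpha>/2 + 3 n^2/16 for \<psi> and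
  1/4 for the sine.\<close>

lemma DERIV_sturm_wronskian:
  assumes "a < t" "t < a + 2 * pi"
  shows "(sturm_wronskian a has_real_derivative
     - (\<alpha> / 2 - 1 / 4 + 3 * (n a t)\<^sup>2 / 16) * (\<psi> a t * sin ((t - a) / 2))) (at t)"
proof -
  have S: "((\<lambda>t. sin ((t - a) / 2)) has_real_derivative cos ((t - a) / 2) / 2) (at t)"
    and C: "((\<lambda>t. cos ((t - a) / 2) / 2) has_real_derivative - sin ((t - a) / 2) / 4) (at t)"
    by (auto intro!: derivative_eq_intros)
  from DERIV_mult[OF DERIV_\<psi>[OF assms] DERIV_diff[OF DERIV_mult[OF DERIV_r[OF assms] S] C]]
  show ?thesis
    unfolding sturm_wronskian_def[abs_def]
    by (rule DERIV_cong) (simp add: algebra_simps power2_eq_square)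
qed

text \<open>Serves both ends, \<open>b = a\<close> and \<open>b = a + 2 * pi\<close>. There
  \<open>r\<close> has a simple pole with residue (2 + 2)/4, compensated by the zero of the sine,
  while \<psi> tends to 0.\<close>

lemma isCont_sturm_wronskian_double_zero:
  assumes z: "f a b = 0" "f1 a b = 0" "f2 a b = 1" "g a b = 0" "g1 a b = 0" "g2 a b = 1"
    and b: "sin ((b - a) / 2) = 0"
  shows "isCont (sturm_wronskian a) b"
proof -
  let ?S = "\<lambda>t. sin ((t - a) / 2)" and ?c = "cos ((b - a) / 2) / 2"
  have "(?S has_real_derivative ?c) (at b)"
    by (auto intro!: derivative_eq_intros)
  then have S: "((\<lambda>t. ?S t / (t - b)) \<longlongrightarrow> ?c) (at b)"
    using simple_zero_quotient b by blast
  have F: "((\<lambda>t. f1 a t / f a t * (t - b)) \<longlongrightarrow> 2) (at b)"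
    using double_zero_log_derivative[OF DERIV_f, of a 1 b] DERIV_f1[of a b] z by simp
  have G: "((\<lambda>t. g1 a t / g a t * (t - b)) \<longlongrightarrow> 2) (at b)"
    using double_zero_log_derivative[OF DERIV_g, of a 1 b] DERIV_g1[of a b] z by simp
  have "((\<lambda>t. (f1 a t / f a t * (t - b) + g1 a t / g a t * (t - b)) / 4 * (?S t / (t - b)))
      \<longlongrightarrow> (2 + 2) / 4 * ?c) (at b)"
    by (intro tendsto_intros F G S) simp
  then have rS: "((\<lambda>t. r a t * ?S t) \<longlongrightarrow> (2 + 2) / 4 * ?c) (at b)"
    by (rule Lim_transform_eventually)
      (auto simp: eventually_at_filter r_def field_simps)
  have "isCont (\<psi> a) b"
    unfolding \<psi>_def[abs_def]
    by (intro continuous_intros) (auto intro: DERIV_isCont DERIV_f DERIV_g)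
  then have "(\<psi> a \<longlongrightarrow> 0) (at b)"
    using z by (simp add: isCont_def \<psi>_def)
  then have "(sturm_wronskian a \<longlongrightarrow> 0 * ((2 + 2) / 4 * ?c - ?c)) (at b)"
    unfolding sturm_wronskian_def[abs_def]
    by (intro tendsto_intros rS) auto
  moreover have "sturm_wronskian a b = 0"
    using z by (simp add: sturm_wronskian_def \<psi>_def)
  ultimately show ?thesis by (simp add: isCont_def)
qed

text \<open>For \<open>\<alpha> \<ge> 1 / 2\<close> the Wronskian does not increase, yet it is 0 at
  both ends, so it vanishes throughout. Its derivative then vanishes too; as \<psi> times the sine
  is positive, the nonnegative terms \<alpha>/2 - 1/4 and 3 n^2/16 are both 0.\<close>

lemma log_derivatives_agree:
  assumes "\<alpha> \<ge> 1 / 2" and t: "a < t" "t < a + 2 * pi"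
  shows "\<alpha> = 1 / 2" "n a t = 0"
proof -
  let ?b = "a + 2 * pi" and ?Q = "sturm_wronskian a"
  let ?Q' = "\<lambda>t. - (\<alpha> / 2 - 1 / 4 + 3 * (n a t)\<^sup>2 / 16) * (\<psi> a t * sin ((t - a) / 2))"
  have pos: "\<psi> a u * sin ((u - a) / 2) > 0" if "a < u" "u < ?b" for u
    using fg_pos[OF that] that by (auto simp: \<psi>_def intro!: mult_pos_pos sin_gt_zero)
  have cont: "isCont ?Q u" if u: "a \<le> u" "u \<le> ?b" for u
  proof -
    consider "u = a" | "u = ?b" | "a < u" "u < ?b" using u by force
    then show ?thesis
    proof cases
      case 1 then show ?thesis
        using isCont_sturm_wronskian_double_zero[of a a] by (simp add: double_zero_fg)
    next
      case 2 then show ?thesis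
        using isCont_sturm_wronskian_double_zero[of a ?b] by (simp add: double_zero_fg periodic_fg)
    next
      case 3 then show ?thesis using DERIV_sturm_wronskian DERIV_isCont by blast
    qed
  qed
  have D: "\<exists>d. (?Q has_real_derivative d) (at u) \<and> d \<le> 0" if "a < u" "u < ?b" for u
  proof (intro exI[of _ "?Q' u"] conjI mult_nonpos_nonneg)
    have "3 * (n a u)\<^sup>2 / 16 \<ge> 0" by simp
    then show "- (\<alpha> / 2 - 1 / 4 + 3 * (n a u)\<^sup>2 / 16) \<le> 0" using assms(1) by linarith
  qed (use DERIV_sturm_wronskian[OF that] pos[OF that] in auto)
  have dec: "?Q v \<le> ?Q u" if "a \<le> u" "u \<le> v" "v \<le> ?b" for u v
    using that by (intro DERIV_nonpos_imp_decreasing_open[of u v ?Q] D)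
      (auto intro!: continuous_at_imp_continuous_on cont)
  have "?Q a = 0" "?Q ?b = 0"
    by (simp_all add: sturm_wronskian_def \<psi>_def double_zero_fg periodic_fg)
  then have zero: "?Q u = 0" if "a < u" "u < ?b" for u
    using dec[of a u] dec[of u ?b] that by simp
  have "((\<lambda>_. 0) has_real_derivative ?Q' t) (at t)"
    using DERIV_sturm_wronskian[OF t]
    by (rule has_field_derivative_transform_within_open[where S = "{a<..<?b}"]) (use t zero in auto)
  then have "?Q' t = 0" using DERIV_unique DERIV_const by blast
  then have "\<alpha> / 2 - 1 / 4 + 3 * (n a t)\<^sup>2 / 16 = 0"
    using pos[OF t] by (metis less_irrefl mult_eq_0_iff neg_equal_0_iff_equal)
  moreover have "3 * (n a t)\<^sup>2 / 16 \<ge> 0" by simp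
  ultimately have "\<alpha> = 1/2 \<and> 3 * (n a t)\<^sup>2 / 16 = 0" using assms(1) by linarith
  then show "\<alpha> = 1 / 2" "n a t = 0" by simp_all
qed

text \<open>Differentiating f' g = g' f twice leaves only the \<beta> terms, which add up because
  they have opposite signs in the two equations.\<close>

lemma \<beta>_zero:
  assumes "\<alpha> \<ge> 1 / 2"
  shows "\<beta> t = 0"
proof -
  \<comment> \<open>Puts \<open>t\<close> in the middle of a period, where f and g are
    positive.\<close>
  define a where "a = t - pi"
  have t: "a < t" "t < a + 2 * pi" by (simp_all add: a_def)
  let ?I = "{a<..<a + 2 * pi}"
  note pos = fg_pos[OF t]
  \<comment> \<open>An identity on the open interval may be differentiated.\<close>
  have open_eq: "u' = v'" if "\<And>x. x \<in> ?I \<Longrightarrow> u x = v x"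
    "(u has_real_derivative u') (at x)" "(v has_real_derivative v') (at x)" "x \<in> ?I"
    for u v :: "real \<Rightarrow> real" and u' v' x
    using has_field_derivative_transform_within_open[OF that(2), of ?I v] that DERIV_unique by auto
  note [derivative_intros] = DERIV_f DERIV_f1 DERIV_f2 DERIV_g DERIV_g1 DERIV_g2
  have e1: "f1 a x * g a x = g1 a x * f a x" if "x \<in> ?I" for x
    using log_derivatives_agree(2)[OF assms, of a x] fg_pos[of a x] that
    by (simp add: n_def field_simps)
  have e2: "f2 a x * g a x = g2 a x * f a x" if x: "x \<in> ?I" for x
  proof -
    have "f2 a x * g a x + g1 a x * f1 a x = g2 a x * f a x + f1 a x * g1 a x"
      by (rule open_eq[OF e1 _ _ x]) (auto intro!: derivative_eq_intros)
    then show ?thesis by simp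
  qed
  have tI: "t \<in> ?I" using t by simp
  have e3: "(- (2 * \<alpha>) * f1 a t - \<beta> t * f a t) * g a t + g1 a t * f2 a t
      = (- (2 * \<alpha>) * g1 a t + \<beta> t * g a t) * f a t + f1 a t * g2 a t"
    by (rule open_eq[OF e2 _ _ tI]) (auto intro!: derivative_eq_intros)
  \<comment> \<open>The mixed terms of \<open>e3\<close> agree, by \<open>e1\<close> and
    \<open>e2\<close>.\<close>
  have "(g1 a t * f2 a t) * (f a t * g a t) = (f1 a t * g2 a t) * (f a t * g a t)"
    using e1[OF tI] e2[OF tI] by algebra
  then have "g1 a t * f2 a t = f1 a t * g2 a t" using pos by simp
  then have "2 * \<beta> t * (f a t * g a t) = 0"
    using e3 e1[OF tI] by algebra
  then show ?thesis using pos by simp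
qed

subsection \<open>The ellipsoidal case\<close>

text \<open>Here the equation is y''' = - y'. So y + y'' is constant, and undoing the unit speed
  rotation of (y', y'') yields two more constant vectors.\<close>

lemma lift_is_conic:
  assumes a: "\<alpha> \<ge> 1 / 2"
  shows "y t = (y 0 + y2 0) + cos t *\<^sub>R (- y2 0) + sin t *\<^sub>R y1 0"
    and "y1 t = cos t *\<^sub>R y1 0 - sin t *\<^sub>R (- y2 0)"
proof -
  have \<alpha>: "\<alpha> = 1 / 2"
    using log_derivatives_agree(1)[OF a, of 0 pi] by simp
  have D2: "(y2 has_vector_derivative - y1 t) (at t)" for t
    using deriv_y2[of t] \<beta>_zero[OF a] by (simp add: \<alpha>)
  note [derivative_intros] = deriv_y deriv_y1 D2
  have "((\<lambda>t. y t + y2 t) has_vector_derivative y1 t + - y1 t) (at t)" for t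
    by (intro derivative_intros)
  then have A: "y t + y2 t = y 0 + y2 0"
    using zero_vector_derivative_imp_constant[of "\<lambda>t. y t + y2 t" t] by simp
  have "((\<lambda>t. cos t *\<^sub>R y1 t - sin t *\<^sub>R y2 t) has_vector_derivative
      (cos t *\<^sub>R y2 t + (- sin t) *\<^sub>R y1 t) - (sin t *\<^sub>R (- y1 t) + cos t *\<^sub>R y2 t)) (at t)" for t
    by (intro derivative_intros has_vector_derivative_scaleR DERIV_sin DERIV_cos)
  then have E1: "cos t *\<^sub>R y1 t - sin t *\<^sub>R y2 t = y1 0"
    using zero_vector_derivative_imp_constant[of "\<lambda>t. cos t *\<^sub>R y1 t - sin t *\<^sub>R y2 t" t] by simp
  have "((\<lambda>t. sin t *\<^sub>R y1 t + cos t *\<^sub>R y2 t) has_vector_derivative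
      (sin t *\<^sub>R y2 t + cos t *\<^sub>R y1 t) + (cos t *\<^sub>R (- y1 t) + (- sin t) *\<^sub>R y2 t)) (at t)" for t
    by (intro derivative_intros has_vector_derivative_scaleR DERIV_sin DERIV_cos)
  then have E2: "sin t *\<^sub>R y1 t + cos t *\<^sub>R y2 t = y2 0"
    using zero_vector_derivative_imp_constant[of "\<lambda>t. sin t *\<^sub>R y1 t + cos t *\<^sub>R y2 t" t] by simp
  have sq: "cos t * cos t + sin t * sin t = 1"
    using sin_cos_squared_add[of t] by (simp add: power2_eq_square)
  have "cos t *\<^sub>R y1 0 + sin t *\<^sub>R y2 0 = (cos t * cos t) *\<^sub>R y1 t + (sin t * sin t) *\<^sub>R y1 t"
    unfolding E1[symmetric] E2[symmetric] by (simp add: algebra_simps)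
  then show "y1 t = cos t *\<^sub>R y1 0 - sin t *\<^sub>R (- y2 0)" unfolding scaleR_add_left[symmetric] sq by simp
  have "cos t *\<^sub>R y2 0 - sin t *\<^sub>R y1 0 = (cos t * cos t) *\<^sub>R y2 t + (sin t * sin t) *\<^sub>R y2 t"
    unfolding E1[symmetric] E2[symmetric] by (simp add: algebra_simps)
  then have "y2 t = cos t *\<^sub>R y2 0 - sin t *\<^sub>R y1 0" unfolding scaleR_add_left[symmetric] sq by simp
  moreover have "y t = y 0 + y2 0 - y2 t"
    using A by (metis add_diff_cancel_right')
  ultimately show "y t = (y 0 + y2 0) + cos t *\<^sub>R (- y2 0) + sin t *\<^sub>R y1 0"
    by simp
qed

text \<open>In the basis \<open>A\<close>, \<open>B\<close>, \<open>C\<close> the curve is (1, cos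
  t, sin t). Its tangent planes cut out the Lorentz cone, which gives one inclusion; conversely each
  point of that cone is a nonnegative combination of two opposite points of the circle.\<close>

lemma ellipsoidal_if_\<alpha>_ge_half:
  assumes a: "\<alpha> \<ge> 1 / 2"
  shows "ellipsoidal_cone K"
proof -
  define A where "A = y 0 + y2 0"
  define B where "B = - y2 0"
  define C where "C = y1 0"
  have yt: "y t = A + cos t *\<^sub>R B + sin t *\<^sub>R C" and y1t: "y1 t = cos t *\<^sub>R C - sin t *\<^sub>R B" for t
    unfolding A_def B_def C_def by (rule lift_is_conic[OF a])+
  have dABC: "det3 A B C = - 1"
    using unit_det[of 0]
    by (simp add: A_def B_def C_def det3_linear_simps det3_swap(1)[of "y 0" "y2 0"]
        det3_swap(2)[of "y2 0" "y1 0" "y 0"])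
  define M :: "real^3^3" where "M = transpose (vector [A, B, C])"
  have Mv: "M *v x = x$1 *\<^sub>R A + x$2 *\<^sub>R B + x$3 *\<^sub>R C" for x
    by (simp add: M_def vec_eq_iff matrix_vector_mult_def transpose_def sum_3)
  have "det M = det3 A B C"
    by (simp add: M_def det3_def det_transpose)
  then have inv: "invertible M"
    by (simp add: invertible_det_nz dABC)
  have "K = (\<lambda>x. M *v x) ` lorentz_cone"
  proof (intro equalityI subsetI)
    fix x assume x: "x \<in> K"
    \<comment> \<open>Coordinates by Cramer's rule; the signs come from the determinant -1.\<close>
    define u :: "real^3" where "u = vector [- det3 x B C, - det3 A x C, - det3 A B x]"
    have xu: "x = u$1 *\<^sub>R A + u$2 *\<^sub>R B + u$3 *\<^sub>R C"
      using arg_cong[OF det3_cramer[of A B C x], of uminus] by (simp add: dABC u_def)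
    have ineq: "u$2 * cos t + u$3 * sin t \<le> u$1" for t
    proof -
      have sq: "cos t * cos t + sin t * sin t = 1"
        using sin_cos_squared_add[of t] by (simp add: power2_eq_square)
      have perm: "det3 A C B = 1" "det3 B A C = 1" "det3 B C A = -1" "det3 C A B = -1" "det3 C B A = 1"
        using dABC by (simp_all add: det3_expand algebra_simps)
      have "0 \<le> det3 x (y1 t) (y t)" by (rule tangent_plane_supports[OF x])
      also have "\<dots> = u$1 * cos t * cos t + u$1 * sin t * sin t - (u$2 * cos t + u$3 * sin t)"
        by (subst xu) (simp add: yt y1t det3_linear_simps dABC perm algebra_simps)
      also have "\<dots> = u$1 - (u$2 * cos t + u$3 * sin t)"
        using sq by algebra
      finally show ?thesis by simp
    qed
    obtain \<rho> \<theta> where \<rho>: "u$2 = \<rho> * cos \<theta>" "u$3 = \<rho> * sin \<theta>"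
      using polar_Ex by metis
    have "\<rho> * cos \<theta> * cos \<theta> + \<rho> * sin \<theta> * sin \<theta> = \<rho>"
      using sin_cos_squared_add[of \<theta>] by algebra
    \<comment> \<open>The sign of \<rho> is left open by \<open>polar_Ex\<close>, so the inequality
      is tested at \<theta> and at the opposite angle.\<close>
    then have "\<bar>\<rho>\<bar> \<le> u$1"
      using ineq[of \<theta>] ineq[of "\<theta> + pi"] by (auto simp: \<rho> abs_le_iff)
    moreover have "sqrt ((u$2)\<^sup>2 + (u$3)\<^sup>2) = \<bar>\<rho>\<bar>"
      by (simp add: \<rho> power_mult_distrib flip: distrib_left)
    ultimately have "u \<in> lorentz_cone" by (simp add: lorentz_cone_def)
    then show "x \<in> (\<lambda>x. M *v x) ` lorentz_cone" using xu Mv by (metis image_eqI)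
  next
    fix x assume "x \<in> (\<lambda>x. M *v x) ` lorentz_cone"
    then obtain u where u: "u \<in> lorentz_cone" and x: "x = M *v u" by blast
    obtain \<rho> \<theta> where \<rho>: "u$2 = \<rho> * cos \<theta>" "u$3 = \<rho> * sin \<theta>"
      using polar_Ex by metis
    have "sqrt ((u$2)\<^sup>2 + (u$3)\<^sup>2) = \<bar>\<rho>\<bar>"
      by (simp add: \<rho> power_mult_distrib flip: distrib_left)
    then have "\<bar>\<rho>\<bar> \<le> u$1" using u by (simp add: lorentz_cone_def)
    then have "((u$1 + \<rho>) / 2) *\<^sub>R y \<theta> \<in> K" "((u$1 - \<rho>) / 2) *\<^sub>R y (\<theta> + pi) \<in> K"
      by (auto intro!: scale_in_K lift_in_K)
    then have "((u$1 + \<rho>) / 2) *\<^sub>R y \<theta> + ((u$1 - \<rho>) / 2) *\<^sub>R y (\<theta> + pi) \<in> K"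
      using convex_cone[of K] convex_K cone_K by blast
    moreover have "((u$1 + \<rho>) / 2) *\<^sub>R y \<theta> + ((u$1 - \<rho>) / 2) *\<^sub>R y (\<theta> + pi) = x"
      by (simp add: x Mv yt \<rho> vec_eq_iff field_simps)
    ultimately show "x \<in> K" by simp
  qed
  with inv show ?thesis unfolding ellipsoidal_cone_def by blast
qed

end

subsection \<open>Change of parameter\<close>

text \<open>The factor \<open>l\<close> will turn out to be the derivative of \<open>s\<close>. So
  far \<open>s\<close> is only continuous, and \<open>s_shift\<close> leaves its degree and
  orientation open.\<close>

locale reparametrized_lifts =
  Y: balanced_lift K y y1 y2 \<alpha> \<beta> + Z: balanced_lift K z z1 z2 \<alpha>' \<beta>'
  for K y y1 y2 \<alpha> \<beta> z z1 z2 \<alpha>' \<beta>' +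
  fixes s l :: "real \<Rightarrow> real"
  assumes same_ray: "z (s t) = l t *\<^sub>R y t"
    and l_pos: "l t > 0"
    and cont_s: "continuous_on UNIV s"
    and s_shift: "\<exists>k::int. s (t + 2 * pi) = s t + 2 * pi * k"
begin

lemma yy_nonzero: "y t \<bullet> y t \<noteq> 0"
  using Y.lift_nonzero by simp

text \<open>Recovers a scale factor from vectors; through it \<open>l\<close>, \<open>l1\<close> and
  \<open>l2\<close> inherit differentiability.\<close>

lemma coefficient_of_lift:
  assumes "w = c *\<^sub>R y t"
  shows "c = (w \<bullet> y t) / (y t \<bullet> y t)"
  using assms yy_nonzero by simp

lemma s_differentiable: "\<exists>d. (s has_real_derivative d) (at t)"
proof -
  \<comment> \<open>an affine coordinate on the projective curve that is regular at the point \<open>z (s t)\<close>\<close>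
  define R where "R x = det3 (z2 (s t)) x (z (s t)) / (x \<bullet> z (s t))" for x
  have zz: "z (s t) \<bullet> z (s t) \<noteq> 0"
    using Z.lift_nonzero by simp
  have yz: "y t \<bullet> z (s t) \<noteq> 0"
    using yy_nonzero[of t] l_pos[of t] by (simp add: same_ray)
  have inn: "((\<lambda>x. w x \<bullet> z (s t)) has_real_derivative w' \<bullet> z (s t)) (at x)"
    if "(w has_vector_derivative w') (at x)" for w w' x
    using DERIV_inner[OF that has_vector_derivative_const, of "z (s t)"] by simp
  have det: "((\<lambda>x. det3 (z2 (s t)) (w x) (z (s t))) has_real_derivative det3 (z2 (s t)) w' (z (s t))) (at x)"
    if "(w has_vector_derivative w') (at x)" for w w' x
    using DERIV_det3[OF has_vector_derivative_const that has_vector_derivative_const, of "z2 (s t)" "z (s t)"]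
    by (simp add: det3_linear_simps)
  have "((\<lambda>\<sigma>. R (z \<sigma>)) has_real_derivative 1 / (z (s t) \<bullet> z (s t))) (at (s t))"
    unfolding R_def
    using DERIV_divide[OF det[OF Z.deriv_y[of "s t"]] inn[OF Z.deriv_y[of "s t"]] zz] zz
    by (simp add: Z.unit_det det3_linear_simps)
  \<comment> \<open>\<open>R\<close> is homogeneous of degree 0, so it does not see the factor
    \<open>l\<close>; along \<open>y\<close> it is differentiable at \<open>t\<close>.\<close>
  moreover have "R (z (s x)) = R (y x)" for x
    using l_pos[of x] by (simp add: R_def same_ray[of x] det3_linear_simps)
  then have "\<exists>e. ((\<lambda>x. R (z (s x))) has_real_derivative e) (at t)"
    using DERIV_divide[OF det[OF Y.deriv_y[of t]] inn[OF Y.deriv_y[of t]] yz]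
    unfolding R_def by auto
  moreover have "isCont s t"
    using cont_s by (simp add: continuous_on_eq_continuous_at)
  ultimately show ?thesis
    using DERIV_of_DERIV_compose[of "\<lambda>\<sigma>. R (z \<sigma>)" "1 / (z (s t) \<bullet> z (s t))" s t] zz by auto
qed

lemma deriv_compose_s:
  assumes "(w has_vector_derivative w') (at (s t))" "(s has_real_derivative u) (at t)"
  shows "((\<lambda>t. w (s t)) has_vector_derivative u *\<^sub>R w') (at t)"
  using vector_diff_chain_at[of s u t w w'] assms
  by (simp add: o_def has_real_derivative_iff_has_vector_derivative)

text \<open>A bootstrap: \<open>l\<close>, \<open>u\<close> (the derivative of \<open>s\<close>),
  \<open>l1\<close> and \<open>l2\<close> are in turn expressed through functions already known to
  be differentiable. The unit determinants of both lifts force \<open>u = l\<close>.\<close>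

lemma scale_derivatives:
  obtains l1 l2 l3 where
    "\<And>t. (s has_real_derivative l t) (at t)"
    "\<And>t. (l has_real_derivative l1 t) (at t)"
    "\<And>t. (l1 has_real_derivative l2 t) (at t)"
    "\<And>t. (l2 has_real_derivative l3 t) (at t)"
    "\<And>t. l t *\<^sub>R z1 (s t) = l1 t *\<^sub>R y t + l t *\<^sub>R y1 t"
    "\<And>t. l1 t *\<^sub>R z1 (s t) + (l t)\<^sup>2 *\<^sub>R z2 (s t) = l2 t *\<^sub>R y t + (2 * l1 t) *\<^sub>R y1 t + l t *\<^sub>R y2 t"
proof -
  obtain u where ds: "\<And>t. (s has_real_derivative u t) (at t)"
    using s_differentiable by metis
  note dz = deriv_compose_s[OF Z.deriv_y ds] and dz1 = deriv_compose_s[OF Z.deriv_y1 ds]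
    and dz2 = deriv_compose_s[OF Z.deriv_y2 ds]
  have l_eq: "l = (\<lambda>t. (z (s t) \<bullet> y t) / (y t \<bullet> y t))"
    using coefficient_of_lift[OF same_ray] by auto
  have "\<exists>d. (l has_real_derivative d) (at t)" for t
    unfolding l_eq by (rule inner_ratio_differentiable[OF dz Y.deriv_y Y.lift_nonzero])
  then obtain l1 where dl: "\<And>t. (l has_real_derivative l1 t) (at t)" by metis
  have e1: "u t *\<^sub>R z1 (s t) = l1 t *\<^sub>R y t + l t *\<^sub>R y1 t" for t
  proof (rule vector_derivative_unique_at[OF dz])
    show "((\<lambda>t. z (s t)) has_vector_derivative l1 t *\<^sub>R y t + l t *\<^sub>R y1 t) (at t)"
      unfolding same_ray using has_vector_derivative_scaleR[OF dl Y.deriv_y]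
      by (simp add: add.commute)
  qed
  \<comment> \<open>This determinant kills \<open>y t\<close> and so isolates
    \<open>u t\<close>.\<close>
  have ud: "u t * det3 (z1 (s t)) (y2 t) (y t) = - l t" for t
    using arg_cong[OF e1[of t], of "\<lambda>v. det3 v (y2 t) (y t)"]
    by (simp add: det3_linear_simps det3_swap(1)[of "y1 t" "y2 t"] Y.unit_det)
  have dnz: "det3 (z1 (s t)) (y2 t) (y t) \<noteq> 0" for t
    using ud[of t] l_pos[of t] by auto
  have u_eq: "u = (\<lambda>t. - l t / det3 (z1 (s t)) (y2 t) (y t))"
    using ud dnz by (auto simp: field_simps)
  have "\<exists>d. (u has_real_derivative d) (at t)" for t
    unfolding u_eq
    using DERIV_divide[OF DERIV_minus[OF dl] DERIV_det3[OF dz1 Y.deriv_y2 Y.deriv_y] dnz] by blast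
  then obtain u1 where du: "\<And>t. (u has_real_derivative u1 t) (at t)" by metis
  have l1_eq: "l1 = (\<lambda>t. ((u t *\<^sub>R z1 (s t) - l t *\<^sub>R y1 t) \<bullet> y t) / (y t \<bullet> y t))"
    using e1 by (intro ext coefficient_of_lift) simp
  have "\<exists>d. (l1 has_real_derivative d) (at t)" for t
    unfolding l1_eq
    by (rule inner_ratio_differentiable[OF has_vector_derivative_diff[OF
          has_vector_derivative_scaleR[OF du dz1] has_vector_derivative_scaleR[OF dl Y.deriv_y1]]
          Y.deriv_y Y.lift_nonzero])
  then obtain l2 where dl1: "\<And>t. (l1 has_real_derivative l2 t) (at t)" by metis
  have e2: "u1 t *\<^sub>R z1 (s t) + (u t)\<^sup>2 *\<^sub>R z2 (s t)
      = l2 t *\<^sub>R y t + (2 * l1 t) *\<^sub>R y1 t + l t *\<^sub>R y2 t" for t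
  proof (rule vector_derivative_unique_at)
    show "((\<lambda>t. u t *\<^sub>R z1 (s t)) has_vector_derivative u1 t *\<^sub>R z1 (s t) + (u t)\<^sup>2 *\<^sub>R z2 (s t)) (at t)"
      using has_vector_derivative_scaleR[OF du dz1, of t]
      by (simp add: power2_eq_square add.commute)
    show "((\<lambda>t. u t *\<^sub>R z1 (s t)) has_vector_derivative
        l2 t *\<^sub>R y t + (2 * l1 t) *\<^sub>R y1 t + l t *\<^sub>R y2 t) (at t)"
      unfolding e1
      using has_vector_derivative_add[OF has_vector_derivative_scaleR[OF dl1 Y.deriv_y]
          has_vector_derivative_scaleR[OF dl Y.deriv_y1], of t]
      by (simp add: algebra_simps scaleR_2 flip: scaleR_scaleR)
  qed
  have "u t = l t" for t
  proof (rule cube_eq_imp_eq)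
    \<comment> \<open>The determinant of the second, first and zeroth derivatives of z(s(t)),
      computed through \<open>z\<close> and then through l y.\<close>
    have "u t ^ 3 = det3 (u1 t *\<^sub>R z1 (s t) + (u t)\<^sup>2 *\<^sub>R z2 (s t)) (u t *\<^sub>R z1 (s t)) (z (s t))"
      by (simp add: det3_linear_simps Z.unit_det power2_eq_square power3_eq_cube)
    also have "\<dots> = l t ^ 3"
      unfolding e1 e2 same_ray
      by (simp add: det3_linear_simps Y.unit_det power3_eq_cube)
    finally show "u t ^ 3 = l t ^ 3" .
  qed (rule l_pos)
  then have ul: "u = l" by auto
  have u1l: "u1 = l1"
    using du dl DERIV_unique unfolding ul by blast
  have l2_eq: "l2 = (\<lambda>t. ((l1 t *\<^sub>R z1 (s t) + (l t)\<^sup>2 *\<^sub>R z2 (s t) - (2 * l1 t) *\<^sub>R y1 t - l t *\<^sub>R y2 t) \<bullet> y t)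
      / (y t \<bullet> y t))"
    using e2 unfolding ul u1l by (intro ext coefficient_of_lift) simp
  have "\<exists>d. (l2 has_real_derivative d) (at t)" for t
    unfolding l2_eq
    by (rule inner_ratio_differentiable[OF has_vector_derivative_diff[OF has_vector_derivative_diff[OF
          has_vector_derivative_add[OF has_vector_derivative_scaleR[OF dl1 dz1]
            has_vector_derivative_scaleR[OF DERIV_power[OF dl] dz2]]
          has_vector_derivative_scaleR[OF DERIV_cmult[OF dl1] Y.deriv_y1]]
          has_vector_derivative_scaleR[OF dl Y.deriv_y2]]
          Y.deriv_y Y.lift_nonzero])
  then obtain l3 where dl2: "\<And>t. (l2 has_real_derivative l3 t) (at t)" by metis
  show thesis
    by (rule that[OF ds[unfolded ul] dl dl1 dl2 e1[unfolded ul] e2[unfolded ul u1l]])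
qed

text \<open>The transformation law of \<open>\<alpha>\<close> involves the Schwarzian of \<open>s\<close>; for constant
  \<open>\<alpha>\<close>, \<open>\<alpha>'\<close> it becomes linear in \<open>W = 1/s'\<close>: \<open>W''' + 2\<alpha> W' = 0\<close>.\<close>
lemma scale_constant:
  assumes "\<alpha> < 1 / 2"
  shows "\<exists>\<mu>>0. \<forall>t. (s has_real_derivative \<mu>) (at t)"
proof -
  obtain l1 l2 l3 where ds: "\<And>t. (s has_real_derivative l t) (at t)"
    and dl: "\<And>t. (l has_real_derivative l1 t) (at t)"
    and dl1: "\<And>t. (l1 has_real_derivative l2 t) (at t)"
    and dl2: "\<And>t. (l2 has_real_derivative l3 t) (at t)"
    and e1: "\<And>t. l t *\<^sub>R z1 (s t) = l1 t *\<^sub>R y t + l t *\<^sub>R y1 t"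
    and e2: "\<And>t. l1 t *\<^sub>R z1 (s t) + (l t)\<^sup>2 *\<^sub>R z2 (s t) = l2 t *\<^sub>R y t + (2 * l1 t) *\<^sub>R y1 t + l t *\<^sub>R y2 t"
    using scale_derivatives by blast
  note dz1 = deriv_compose_s[OF Z.deriv_y1 ds] and dz2 = deriv_compose_s[OF Z.deriv_y2 ds]
  \<comment> \<open>The second order relation differentiated once more, with both third order
    equations inserted.\<close>
  have e3: "l1 t *\<^sub>R (l t *\<^sub>R z2 (s t)) + l2 t *\<^sub>R z1 (s t)
        + ((l t)\<^sup>2 *\<^sub>R (l t *\<^sub>R (- (2 * \<alpha>') *\<^sub>R z1 (s t) - \<beta>' (s t) *\<^sub>R z (s t))) + (2 * l t * l1 t) *\<^sub>R z2 (s t))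
      = l2 t *\<^sub>R y1 t + l3 t *\<^sub>R y t + ((2 * l1 t) *\<^sub>R y2 t + (2 * l2 t) *\<^sub>R y1 t)
        + (l t *\<^sub>R (- (2 * \<alpha>) *\<^sub>R y1 t - \<beta> t *\<^sub>R y t) + l1 t *\<^sub>R y2 t)" for t
  proof (rule vector_derivative_unique_at)
    have "((\<lambda>t. (l t)\<^sup>2) has_real_derivative 2 * l t * l1 t) (at t)"
      by (auto intro!: derivative_eq_intros dl)
    from has_vector_derivative_add[OF has_vector_derivative_scaleR[OF dl1 dz1] has_vector_derivative_scaleR[OF this dz2]]
    show "((\<lambda>t. l1 t *\<^sub>R z1 (s t) + (l t)\<^sup>2 *\<^sub>R z2 (s t)) has_vector_derivative
       l1 t *\<^sub>R (l t *\<^sub>R z2 (s t)) + l2 t *\<^sub>R z1 (s t)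
        + ((l t)\<^sup>2 *\<^sub>R (l t *\<^sub>R (- (2 * \<alpha>') *\<^sub>R z1 (s t) - \<beta>' (s t) *\<^sub>R z (s t))) + (2 * l t * l1 t) *\<^sub>R z2 (s t))) (at t)" .
    show "((\<lambda>t. l1 t *\<^sub>R z1 (s t) + (l t)\<^sup>2 *\<^sub>R z2 (s t)) has_vector_derivative
       l2 t *\<^sub>R y1 t + l3 t *\<^sub>R y t + ((2 * l1 t) *\<^sub>R y2 t + (2 * l2 t) *\<^sub>R y1 t)
        + (l t *\<^sub>R (- (2 * \<alpha>) *\<^sub>R y1 t - \<beta> t *\<^sub>R y t) + l1 t *\<^sub>R y2 t)) (at t)"
      unfolding e2
      by (intro has_vector_derivative_add has_vector_derivative_scaleR Y.deriv_y Y.deriv_y1 Y.deriv_y2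
          dl dl1 dl2 DERIV_cmult)
  qed
  have l2: "l2 t = 3 * (l1 t)\<^sup>2 / (2 * l t) - \<alpha>' * l t ^ 3 + \<alpha> * l t" for t
  proof -
    \<comment> \<open>The \<open>y1\<close> coordinate in the frame of \<open>y\<close>; it kills
      \<open>y t\<close>, \<open>y2 t\<close> and \<open>z (s t)\<close>, hence both \<beta>
      terms.\<close>
    define d where "d v = det3 (y2 t) v (y t)" for v
    have d_simps: "d (v + w) = d v + d w" "d (v - w) = d v - d w" "d (- v) = - d v" "d (c *\<^sub>R v) = c * d v" for v w c
      by (simp_all add: d_def det3_linear_simps)
    have dy: "d (y t) = 0" "d (y1 t) = 1" "d (y2 t) = 0" "d (z (s t)) = 0"
      by (simp_all add: d_def det3_linear_simps Y.unit_det same_ray)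
    have lt: "l t \<noteq> 0" using l_pos[of t] by simp
    have dz1: "d (z1 (s t)) = 1"
      using arg_cong[OF e1[of t], of d] lt by (simp add: d_simps dy)
    have dz2: "(l t)\<^sup>2 * d (z2 (s t)) = l1 t"
      using arg_cong[OF e2[of t], of d] by (simp add: d_simps dy dz1)
    have "3 * l1 t * (l t * d (z2 (s t))) + l2 t - 2 * \<alpha>' * l t ^ 3 = 3 * l2 t - 2 * \<alpha> * l t"
      using arg_cong[OF e3[of t], of d]
      by (simp add: d_simps dy dz1 power2_eq_square power3_eq_cube algebra_simps)
    moreover have "l t * d (z2 (s t)) = l1 t / l t"
      using dz2 lt by (simp add: field_simps power2_eq_square)
    ultimately show ?thesis using lt by (simp add: power2_eq_square field_simps)
  qed
  define W where "W t = 1 / l t" for t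
  \<comment> \<open>\<open>V\<close> and \<open>V1\<close> are W' and W'', with l'' eliminated by
    \<open>l2\<close>.\<close>
  define V where "V t = - l1 t / (l t)\<^sup>2" for t
  define V1 where "V1 t = (l1 t)\<^sup>2 / (2 * l t ^ 3) + \<alpha>' * l t - \<alpha> / l t" for t
  have lnz: "l t \<noteq> 0" for t using l_pos[of t] by simp
  note [derivative_intros] = dl dl1
  have WV: "(W has_real_derivative V t) (at t)" for t
    unfolding W_def V_def
    by (rule derivative_eq_intros refl lnz)+ (simp add: power2_eq_square)
  have VV1: "(V has_real_derivative V1 t) (at t)" for t
    unfolding V_def V1_def using lnz[of t]
    by (auto intro!: derivative_eq_intros simp: l2 power2_eq_square power3_eq_cube field_simps)
  have V1V: "(V1 has_real_derivative - (2 * \<alpha>) * V t) (at t)" for t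
    unfolding V_def V1_def using lnz[of t]
    by (auto intro!: derivative_eq_intros simp: l2 power2_eq_square power3_eq_cube field_simps)
  \<comment> \<open>A shift of \<open>s\<close> by a multiple of 2 pi leaves \<open>z\<close>
    unchanged, so \<open>l\<close> inherits the period.\<close>
  have perW: "W (t + 2 * pi) = W t" for t
  proof -
    obtain k :: int where k: "s (t + 2 * pi) = s t + 2 * pi * k" using s_shift by blast
    have "z (s (t + 2 * pi)) = z (s t)"
      unfolding k by (rule periodic2pi_int) (simp add: periodic2pi_def Z.periodic)
    then have "l (t + 2 * pi) *\<^sub>R y t = l t *\<^sub>R y t"
      by (simp add: same_ray Y.periodic)
    then show ?thesis using Y.lift_nonzero by (simp add: W_def)
  qed
  have "V t = 0" for t
    by (rule periodic_hill_constant[OF WV VV1 V1V perW]) (use assms in simp)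
  then have "l1 t = 0" for t using lnz by (simp add: V_def)
  then have "l t = l 0" for t using DERIV_isconst_all[of l] dl by metis
  then show ?thesis using ds l_pos by metis
qed

end

section \<open>From balanced parametrizations to lifts, and the conclusion\<close>

lemma cone_pointed:
  assumes "regular_convex_cone K" "x \<in> K" "- x \<in> K"
  shows "x = 0"
proof (rule ccontr)
  assume "x \<noteq> 0"
  moreover have "0 + r *\<^sub>R x \<in> K" for r
  proof (cases "r \<ge> 0")
    case True then show ?thesis using assms by (simp add: regular_convex_cone_def cone_def)
  next
    case False
    have "\<forall>x\<in>K. \<forall>c\<ge>0. c *\<^sub>R x \<in> K" using assms(1) by (simp add: regular_convex_cone_def cone_def)
    from this[rule_format, OF assms(3), of "- r"] False show ?thesis by simp
  qed
  ultimately show False using assms(1) unfolding regular_convex_cone_def by blast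
qed

text \<open>Pointedness of the cone makes the factor between \<open>y t\<close> and the unit vector
  \<open>p t\<close> positive. It also excludes opposite vectors, so injectivity of \<open>p\<close>
  on a period carries over to lines through 0.\<close>

lemma balanced_obtain_lift:
  assumes K: "regular_convex_cone K" and p: "balanced K p"
  obtains y y1 y2 \<alpha> \<beta> where "balanced_lift K y y1 y2 \<alpha> \<beta>" "\<And>t. \<exists>c>0. y t = c *\<^sub>R p t"
proof -
  obtain y \<alpha> \<beta> where y: "diff_times 3 y" "periodic2pi y"
      "\<And>t. y t \<in> frontier K" "\<And>t. \<exists>r. y t = r *\<^sub>R p t"
      "\<And>t. det3 (nderiv 2 y t) (nderiv 1 y t) (y t) = 1"
      "\<And>t. nderiv 3 y t + (2 * \<alpha>) *\<^sub>R nderiv 1 y t + \<beta> t *\<^sub>R y t = 0"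
    and g: "continuous_on UNIV p" "periodic2pi p" "inj_on p {0..<2*pi}"
      "p ` {0..<2*pi} = frontier K \<inter> sphere 0 1"
    using p unfolding balanced_def gamma_param_def by blast
  have D: "(nderiv j y has_vector_derivative nderiv (Suc j) y t) (at t)" if "j < 3" for j t
    using y(1) that unfolding diff_times_def by blast
  have D0: "(y has_vector_derivative nderiv 1 y t) (at t)" for t using D[of 0] by simp
  have D1: "(nderiv 1 y has_vector_derivative nderiv 2 y t) (at t)" for t
    using D[of 1] by (simp add: numeral_2_eq_2 del: nderiv.simps)
  have D2: "(nderiv 2 y has_vector_derivative - (2 * \<alpha>) *\<^sub>R nderiv 1 y t - \<beta> t *\<^sub>R y t) (at t)" for t
  proof -
    have "nderiv 3 y t = - (2 * \<alpha>) *\<^sub>R nderiv 1 y t - \<beta> t *\<^sub>R y t"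
      using y(6)[of t] by (simp add: eq_neg_iff_add_eq_0 algebra_simps del: nderiv.simps)
    then show ?thesis using D[of 2 t] by (simp add: eval_nat_numeral del: nderiv.simps)
  qed
  have yK: "y t \<in> K" for t
    using y(3)[of t] K by (auto simp: regular_convex_cone_def frontier_def)
  have pt: "p t \<in> K" "norm (p t) = 1" for t
  proof -
    obtain t' where "t' \<in> {0..<2 * pi}" "p t = p t'"
      using periodic2pi_representative[OF g(2)] by metis
    then have "p t \<in> frontier K \<inter> sphere 0 1" using g(4) by auto
    then show "p t \<in> K" "norm (p t) = 1"
      using K by (auto simp: regular_convex_cone_def frontier_def)
  qed
  have opp: "c \<ge> 0" if "c *\<^sub>R p t \<in> K" for c t
  proof (rule ccontr)
    assume c: "\<not> c \<ge> 0"
    then have "(- 1 / c) *\<^sub>R (c *\<^sub>R p t) \<in> K"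
      using that K unfolding regular_convex_cone_def cone_def
      by (metis divide_nonpos_neg linorder_not_le neg_le_0_iff_le zero_le_one)
    then have "- p t \<in> K" using c by simp
    then show False using cone_pointed[OF K pt(1)[of t]] pt(2)[of t] by auto
  qed
  have ynz: "y t \<noteq> 0" for t
    using y(5)[of t] by (auto simp: det3_linear_simps)
  have ray: "\<exists>c>0. y t = c *\<^sub>R p t" for t
  proof -
    obtain c where c: "y t = c *\<^sub>R p t" using y(4) by blast
    then have "c \<ge> 0" "c \<noteq> 0" using opp[of c t] yK[of t] ynz[of t] by auto
    then show ?thesis using c by (intro exI[of _ c]) auto
  qed
  have inj: "\<exists>k::int. s = t + 2 * pi * k" if e: "y s = r *\<^sub>R y t" for s t r
  proof -
    obtain a b where a: "a > 0" "y s = a *\<^sub>R p s" and b: "b > 0" "y t = b *\<^sub>R p t" using ray by metis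
    have "p s = (1 / a) *\<^sub>R y s" using a by simp
    then have ps: "p s = (r * b / a) *\<^sub>R p t" using e b by simp
    then have "r * b / a \<ge> 0" using opp pt(1) by metis
    moreover have "\<bar>r * b / a\<bar> = 1" using norm_scaleR[of "r * b / a" "p t"] unfolding ps[symmetric] pt(2) by auto
    ultimately have "r * b / a = 1" by linarith
    then have "p s = p t" using ps by (metis scaleR_one)
    then show ?thesis by (rule periodic2pi_inj_eq[OF g(2,3)])
  qed
  have "balanced_lift K y (nderiv 1 y) (nderiv 2 y) \<alpha> \<beta>"
    by unfold_locales (use K y(2,3,5) D0 D1 D2 inj in \<open>auto simp: periodic2pi_def simp del: nderiv.simps\<close>)
  then show thesis using ray by (rule that)
qed

theorem theorem2:
  fixes K :: "(real^3) set" and k :: nat and p q :: "real \<Rightarrow> real^3"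
  assumes "regular_convex_cone K"
    and "\<not> ellipsoidal_cone K"
    and "k \<ge> 5"
    and "Ck_pos_curved_boundary k K"
    and "balanced K p"
    and "balanced K q"
  shows "\<exists>c::real. \<forall>t. q (t + c) = p t"
proof -
  have p: "continuous_on UNIV p" "periodic2pi p" "inj_on p {0..<2*pi}"
      "p ` {0..<2*pi} = frontier K \<inter> sphere 0 1"
    and q: "continuous_on UNIV q" "periodic2pi q" "inj_on q {0..<2*pi}"
      "q ` {0..<2*pi} = frontier K \<inter> sphere 0 1"
    using assms(5,6) unfolding balanced_def gamma_param_def by auto
  have "p t \<in> range q" for t
  proof -
    obtain t' where "t' \<in> {0..<2 * pi}" "p t = p t'"
      using periodic2pi_representative[OF p(2)] by metis
    then have "p t \<in> q ` {0..<2 * pi}" unfolding q(4) p(4)[symmetric] by blast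
    then show ?thesis by blast
  qed
  then obtain s where s: "continuous_on UNIV s" "\<And>t. p t = q (s t)"
    using closed_curve_lift[OF q(1,2,3) p(1)] by blast
  obtain y y1 y2 \<alpha> \<beta> where Y: "balanced_lift K y y1 y2 \<alpha> \<beta>" and yp: "\<And>t. \<exists>c>0. y t = c *\<^sub>R p t"
    using balanced_obtain_lift[OF assms(1,5)] by metis
  obtain z z1 z2 \<alpha>' \<beta>' where Z: "balanced_lift K z z1 z2 \<alpha>' \<beta>'" and zq: "\<And>t. \<exists>c>0. z t = c *\<^sub>R q t"
    using balanced_obtain_lift[OF assms(1,6)] by metis
  have \<alpha>: "\<alpha> < 1 / 2"
    using balanced_lift.ellipsoidal_if_\<alpha>_ge_half[OF Y] assms(2) by force
  have "\<exists>l>0. z (s t) = l *\<^sub>R y t" for t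
  proof -
    obtain a b where "a > 0" "y t = a *\<^sub>R p t" "b > 0" "z (s t) = b *\<^sub>R q (s t)"
      using yp zq by metis
    then show ?thesis using s(2)[of t] by (intro exI[of _ "b / a"]) auto
  qed
  then obtain l where l: "\<And>t. l t > 0" "\<And>t. z (s t) = l t *\<^sub>R y t" by metis
  have shift: "\<exists>k::int. s (t + 2 * pi) = s t + 2 * pi * k" for t
    by (rule periodic2pi_inj_eq[OF q(2,3)]) (use s(2) p(2) in \<open>simp add: periodic2pi_def flip: s(2)\<close>)
  interpret reparametrized_lifts K y y1 y2 \<alpha> \<beta> z z1 z2 \<alpha>' \<beta>' s l
    using Y Z l s(1) shift by (simp add: reparametrized_lifts_def reparametrized_lifts_axioms_def)
  obtain \<mu> where \<mu>: "\<mu> > 0" "\<And>t. (s has_real_derivative \<mu>) (at t)"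
    using scale_constant[OF \<alpha>] by blast
  have "((\<lambda>t. s t - \<mu> * t) has_real_derivative 0) (at t)" for t
    by (auto intro!: derivative_eq_intros \<mu>(2))
  then have "s t - \<mu> * t = s 0 - \<mu> * 0" for t
    by (rule DERIV_isconst_all[rule_format])
  then have s_affine: "s t = s 0 + \<mu> * t" for t
    by (metis diff_add_cancel diff_zero mult_zero_right)
  \<comment> \<open>The slope is a whole number of turns, and being positive it is at least
    1.\<close>
  obtain m :: int where "s (0 + 2 * pi) = s 0 + 2 * pi * m" using shift by blast
  then have m: "\<mu> = m" using s_affine[of "2 * pi"] by simp
  then have m1: "m \<ge> 1" using \<mu>(1) by simp
  \<comment> \<open>With more than one turn \<open>p\<close> would return to \<open>p 0\<close>
    already at 2 pi / m, inside the first period.\<close>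
  have "m = 1"
  proof (rule ccontr)
    assume "m \<noteq> 1"
    then have "real_of_int m > 1" using m1 by simp
    then have mem: "2 * pi / m \<in> {0..<2 * pi}" by (simp add: field_simps)
    have "s (2 * pi / m) = s 0 + 2 * pi"
      using s_affine[of "2 * pi / m"] m m1 by simp
    then have "p (2 * pi / m) = p 0"
      using s(2) q(2) by (simp add: periodic2pi_def)
    then have "2 * pi / m = 0" using inj_onD[OF p(3) _ mem, of 0] by simp
    then show False using m1 by simp
  qed
  then have "p t = q (t + s 0)" for t
    using s(2)[of t] s_affine[of t] m by (simp add: add.commute)
  then show ?thesis by metis
qed

end
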